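(* Let $n\ge2$, let $w_1,\dots,w_r\in\mathbb{R}^n$ be pairwise distinct points, and let $f(x)=\sum_{i=1}^r\log|x-w_i|^2$ on $\mathbb{R}^n\setminus\{w_1,\dots,w_r\}$. Then the critical points of $f$ are isolated; in particular there is no arc of critical points of $f$.
   Context: $|\cdot|$ is the Euclidean norm. *)

theory Defs
  imports "HOL-Analysis.Analysis"
begin

definition logpot :: "(nat \<Rightarrow> real ^ 'n) \<Rightarrow> nat \<Rightarrow> real ^ 'n \<Rightarrow> real" where
  "logpot w r x = (\<Sum>i<r. ln ((norm (x - w i))\<^sup>2))"

definition crit_points :: "(nat \<Rightarrow> real ^ 'n) \<Rightarrow> nat \<Rightarrow> (real ^ 'n) set" where
  "crit_points w r = {x. x \<notin> w ` {..<r} \<and> (logpot w r has_derivative (\<lambda>h. 0)) (at x)}"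

end

theory Submission
  imports Defs "HOL-Complex_Analysis.Complex_Analysis"
begin

text \<open>
  Critical points of \<open>f\<close> are zeros of the gradient of the polynomial
  \<open>P(x) = \<Prod>\<^sub>i |x - w\<^sub>i|\<^sup>2 = exp (f x)\<close>. The Hessian of \<open>log |x|\<^sup>2\<close> is
  \<open>2 |x|\<^sup>-\<^sup>2 (I - 2 u u\<^sup>T)\<close> with \<open>u = x / |x|\<close>, so its trace over any 2-plane is nonnegative;
  hence the trace of the Hessian of \<open>P\<close> over every 2-plane is positive, unless all \<open>w\<^sub>i\<close> lie in
  one affine plane. In the planar case the critical points are the zeros of the rational function
  \<open>\<Sum>\<^sub>i 1 / (z - z\<^sub>i)\<close>.

  Otherwise the Hessian has a kernel of dimension at most one at each critical point, and by
  analyticity the limit points of the critical set form a compact set \<open>S\<close> that is locally an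
  analytic arc. A gradient descent step \<open>x \<mapsto> x - \<epsilon> \<nabla>P(x)\<close> fixes \<open>S\<close>
  and contracts two-dimensional areas by a factor \<open>\<theta> < 1\<close>. Pulling a 1-form back by its
  iterates does not change the form along \<open>S\<close>, but its exterior derivative tends to 0, so every
  1-form is exact along \<open>S\<close> up to arbitrarily small errors. Walking along \<open>S\<close> one
  eventually closes up a loop, and a bump form supported near a point which the loop passes only
  once has a nonzero integral over the loop, a contradiction.
\<close>

subsection \<open>The product polynomial and its derivatives\<close>

text \<open>The trace condition still allows critical points whose Hessian has a one-dimensional
  kernel, so local analysis alone does not exclude an arc; the exclusion has to be global. The
  geometric reason is an isoperimetric one: a descent step fixes a loop of critical points, while
  the images of a disc spanning that loop have areas tending to 0, which is impossible with a fixed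
  boundary. Working with 1-forms is the dual version of this and needs no spanning disc: a form with
  small exterior derivative on a ball has an approximate primitive, obtained by integration along
  rays.

  \<open>P\<close> replaces \<open>f\<close> because it is a polynomial: it has no singularities, it
  extends to complex vectors, and at each \<open>w i\<close> its Hessian is a positive multiple of
  the identity, so these extra zeros of the gradient are isolated.

  Positivity of the trace is used twice. It limits the kernel of the Hessian to a line, and it
  contracts areas because the area factor of the step on a plane is 1 minus \<epsilon> times the
  trace to first order.\<close>

definition bdot :: "'a::real_normed_field ^ 'n \<Rightarrow> 'a ^ 'n \<Rightarrow> 'a" where
  "bdot x y = (\<Sum>i\<in>UNIV. x $ i * y $ i)"

lemma bdot_real: "bdot x y = x \<bullet> y" for x y :: "real ^ 'n"
  by (simp add: bdot_def inner_vec_def)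

lemma bdot_commute: "bdot x y = bdot y x"
  by (simp add: bdot_def mult.commute)

lemma bounded_bilinear_bdot: "bounded_bilinear (bdot :: 'a::real_normed_field ^ 'n \<Rightarrow> _)"
proof
  have "norm (bdot x y) \<le> norm x * norm y * real CARD('n)" for x y :: "'a ^ 'n"
  proof -
    have "norm (bdot x y) \<le> (\<Sum>i\<in>(UNIV::'n set). norm (x $ i) * norm (y $ i))"
      unfolding bdot_def by (rule sum_norm_le) (simp add: norm_mult)
    also have "\<dots> \<le> (\<Sum>i\<in>(UNIV::'n set). norm x * norm y)"
      by (intro sum_mono mult_mono Finite_Cartesian_Product.norm_nth_le) auto
    finally show ?thesis by (simp add: mult.commute)
  qed
  then show "\<exists>K. \<forall>x y :: 'a ^ 'n. norm (bdot x y) \<le> norm x * norm y * K" by blast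
qed (simp_all add: bdot_def algebra_simps sum.distrib scaleR_sum_right)

lemma norm_vector_scalar_mult: "norm (c *s x) = norm c * norm x"
  for x :: "'a::real_normed_field ^ 'n"
  by (simp add: norm_vec_def norm_mult L2_set_right_distrib)

lemma bounded_bilinear_vector_scalar_mult:
  "bounded_bilinear ((*s) :: 'a::real_normed_field \<Rightarrow> 'a ^ 'n \<Rightarrow> _)"
proof
  show "\<exists>K. \<forall>c (x :: 'a ^ 'n). norm (c *s x) \<le> norm c * norm x * K"
    by (rule exI[of _ 1]) (simp add: norm_vector_scalar_mult)
qed (simp_all add: vec_eq_iff algebra_simps)

interpretation bdot: bounded_bilinear "bdot :: 'a::real_normed_field ^ 'n \<Rightarrow> _"
  by (rule bounded_bilinear_bdot)

interpretation vsm: bounded_bilinear "(*s) :: 'a::real_normed_field \<Rightarrow> 'a ^ 'n \<Rightarrow> _"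
  by (rule bounded_bilinear_vector_scalar_mult)

lemma bdot_smult_left: "bdot (c *s x) y = c * bdot x y"
  and bdot_smult_right: "bdot x (c *s y) = c * bdot x y"
  by (simp_all add: bdot_def sum_distrib_left algebra_simps)

text \<open>\<open>pot\<close> is \<open>P\<close>. The next three recursions are its gradient, the
  derivative of the gradient in direction \<open>h\<close>, and the derivative of
  \<open>phess\<close> at fixed \<open>a\<close> in direction \<open>h\<close>, all read off the
  product rule. The scalars stay general because the same polynomials are needed over the complex
  numbers; \<open>bdot\<close> is bilinear rather than Hermitian to keep them holomorphic
  there.\<close>

primrec pot :: "(nat \<Rightarrow> 'a::real_normed_field ^ 'n) \<Rightarrow> nat \<Rightarrow> 'a ^ 'n \<Rightarrow> 'a" where
  "pot w 0 x = 1"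
| "pot w (Suc r) x = bdot (x - w r) (x - w r) * pot w r x"

primrec pgrad :: "(nat \<Rightarrow> 'a::real_normed_field ^ 'n) \<Rightarrow> nat \<Rightarrow> 'a ^ 'n \<Rightarrow> 'a ^ 'n" where
  "pgrad w 0 x = 0"
| "pgrad w (Suc r) x =
     bdot (x - w r) (x - w r) *s pgrad w r x + (2 * pot w r x) *s (x - w r)"

primrec phess :: "(nat \<Rightarrow> 'a::real_normed_field ^ 'n) \<Rightarrow> nat \<Rightarrow> 'a ^ 'n \<Rightarrow> 'a ^ 'n \<Rightarrow> 'a ^ 'n" where
  "phess w 0 x h = 0"
| "phess w (Suc r) x h =
     bdot (x - w r) (x - w r) *s phess w r x h + (2 * bdot (x - w r) h) *s pgrad w r x
     + (2 * bdot (pgrad w r x) h) *s (x - w r) + (2 * pot w r x) *s h"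

primrec pthird ::
  "(nat \<Rightarrow> 'a::real_normed_field ^ 'n) \<Rightarrow> nat \<Rightarrow> 'a ^ 'n \<Rightarrow> 'a ^ 'n \<Rightarrow> 'a ^ 'n \<Rightarrow> 'a ^ 'n" where
  "pthird w 0 x h a = 0"
| "pthird w (Suc r) x h a =
     bdot (x - w r) (x - w r) *s pthird w r x h a
     + (2 * bdot (x - w r) h) *s phess w r x a + (2 * bdot (x - w r) a) *s phess w r x h
     + (2 * bdot h a) *s pgrad w r x + (2 * bdot (pgrad w r x) a) *s h
     + (2 * bdot (phess w r x h) a) *s (x - w r) + (2 * bdot (pgrad w r x) h) *s a"

lemma bdot_self_has_derivative:
  "((\<lambda>x. bdot (x - a) (x - a)) has_derivative (\<lambda>h. 2 * bdot (x - a) h)) (at x)"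
  by (rule has_derivative_eq_rhs[OF bdot.FDERIV])
    (auto intro!: derivative_eq_intros simp: bdot_commute)

lemma pot_has_derivative:
  "((\<lambda>x. pot w r x) has_derivative (\<lambda>h. bdot (pgrad w r x) h)) (at x)"
proof (induction r)
  case 0
  then show ?case by (simp add: bdot.zero_left)
next
  case (Suc r)
  show ?case
    unfolding pot.simps
    by (rule has_derivative_eq_rhs[OF has_derivative_mult[OF bdot_self_has_derivative Suc]])
      (simp only: pgrad.simps bdot.add_left bdot_smult_left fun_eq_iff, simp add: mult_ac add_ac)
qed

lemma pgrad_has_derivative:
  "((\<lambda>x. pgrad w r x) has_derivative (\<lambda>h. phess w r x h)) (at x)"
proof (induction r)
  case 0
  then show ?case by simp
next
  case (Suc r)
  show ?case
    unfolding pgrad.simps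
    by (rule has_derivative_eq_rhs[OF has_derivative_add[OF
          vsm.FDERIV[OF bdot_self_has_derivative Suc]
          vsm.FDERIV[OF has_derivative_mult_right[OF pot_has_derivative]]]])
      (auto intro!: derivative_eq_intros simp: algebra_simps)
qed

lemma phess_has_derivative:
  assumes a: "(a has_derivative a') (at x)"
  shows "((\<lambda>x. phess w r x (a x)) has_derivative
    (\<lambda>h. pthird w r x h (a x) + phess w r x (a' h))) (at x)"
proof (induction r)
  case 0
  then show ?case by simp
next
  case (Suc r)
  have d: "((\<lambda>x. x - w r) has_derivative (\<lambda>h. h)) (at x)"
    by (auto intro!: derivative_eq_intros)
  show ?case
    unfolding phess.simps
    by (rule has_derivative_eq_rhs[OF has_derivative_add[OF has_derivative_add[OF
          has_derivative_add[OF
          vsm.FDERIV[OF bdot_self_has_derivative Suc]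
          vsm.FDERIV[OF has_derivative_mult_right[OF bdot.FDERIV[OF d a]]
             pgrad_has_derivative]]
          vsm.FDERIV[OF has_derivative_mult_right[OF bdot.FDERIV[OF pgrad_has_derivative a]] d]]
          vsm.FDERIV[OF has_derivative_mult_right[OF pot_has_derivative] a]]])
      (simp add: algebra_simps)
qed

lemma continuous_on_pot [continuous_intros]:
  "continuous_on S f \<Longrightarrow> continuous_on S (\<lambda>s. pot w r (f s))"
  by (induction r) (auto intro!: continuous_intros bdot.continuous_on)

lemma continuous_on_pgrad [continuous_intros]:
  "continuous_on S f \<Longrightarrow> continuous_on S (\<lambda>s. pgrad w r (f s))"
  by (induction r) (auto intro!: continuous_intros bdot.continuous_on vsm.continuous_on)

lemma continuous_on_phess [continuous_intros]:
  "continuous_on S f \<Longrightarrow> continuous_on S u \<Longrightarrow> continuous_on S (\<lambda>s. phess w r (f s) (u s))"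
  by (induction r) (auto intro!: continuous_intros bdot.continuous_on vsm.continuous_on)

lemma continuous_on_pthird [continuous_intros]:
  "continuous_on S f \<Longrightarrow> continuous_on S u \<Longrightarrow> continuous_on S v \<Longrightarrow>
    continuous_on S (\<lambda>s. pthird w r (f s) (u s) (v s))"
  by (induction r) (auto intro!: continuous_intros bdot.continuous_on vsm.continuous_on)

lemma bounded_linear_phess: "bounded_linear (phess w r x)"
  using has_derivative_bounded_linear[OF pgrad_has_derivative] .

lemma phess_smult: "phess w r x (c *s h) = c *s phess w r x h"
  by (induction r) (simp_all add: bdot_smult_right vec_eq_iff algebra_simps)

lemma phess_sym: "bdot (phess w r x h) y = bdot h (phess w r x y)"
proof (induction r)
  case (Suc r)
  define d where "d = x - w r"
  have *: "bdot y (phess w r x h) = bdot h (phess w r x y)"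
    using Suc by (simp add: bdot_commute)
  show ?case
    unfolding phess.simps d_def[symmetric]
    by (simp only: bdot.add_left bdot.add_right bdot_smult_left bdot_smult_right)
      (simp add: * bdot_commute algebra_simps)
qed (simp add: bdot.zero_left bdot.zero_right)

text \<open>Symmetry of third derivatives: the direction of differentiation and the test vector may
  be exchanged. This removes the third-order terms from the exterior derivative of a pulled-back
  form.\<close>

lemma pthird_sym: "bdot (pthird w r x h a) y = bdot (pthird w r x y a) h"
proof (induction r)
  case (Suc r)
  define d where "d = x - w r"
  have "bdot h (phess w r x y) = bdot y (phess w r x h)" for h y
    using phess_sym bdot_commute by metis
  note * = this[of a y] this[of a h] this[of h y]
  have **: "bdot y (pthird w r x h a) = bdot h (pthird w r x y a)"
    using Suc by (simp add: bdot_commute)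
  show ?case
    unfolding pthird.simps d_def[symmetric]
    by (simp only: bdot.add_left bdot.add_right bdot_smult_left bdot_smult_right)
      (simp add: * ** bdot_commute algebra_simps)
qed (simp add: bdot.zero_left)

subsection \<open>Positivity of the Hessian on planes\<close>

text \<open>In dimension at least 2 this says that the two smallest eigenvalues of the Hessian have
  positive sum at every point.\<close>

definition strictly_two_convex :: "(nat \<Rightarrow> real ^ 'n) \<Rightarrow> nat \<Rightarrow> bool" where
  "strictly_two_convex w r \<longleftrightarrow> (\<forall>x a b. norm a = 1 \<longrightarrow> norm b = 1 \<longrightarrow> a \<bullet> b = 0 \<longrightarrow>
     0 < a \<bullet> phess w r x a + b \<bullet> phess w r x b)"

definition lgrad :: "(nat \<Rightarrow> real ^ 'n) \<Rightarrow> nat \<Rightarrow> real ^ 'n \<Rightarrow> real ^ 'n" where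
  "lgrad w r x = (\<Sum>i<r. (2 / ((x - w i) \<bullet> (x - w i))) *\<^sub>R (x - w i))"

lemma pot_pos: "x \<notin> w ` {..<r} \<Longrightarrow> 0 < pot w r x" for x :: "real ^ 'n"
  by (induction r) (auto simp: bdot_real lessThan_Suc)

lemma pgrad_eq_lgrad:
  "x \<notin> w ` {..<r} \<Longrightarrow> pgrad w r x = pot w r x *\<^sub>R lgrad w r x" for x :: "real ^ 'n"
proof (induction r)
  case (Suc r)
  have sc: "c *s v = c *\<^sub>R v" for c and v :: "real ^ 'n" by (simp add: vec_eq_iff)
  have "(x - w r) \<bullet> (x - w r) \<noteq> 0" using Suc.prems by (auto simp: lessThan_Suc)
  moreover have "pgrad w r x = pot w r x *\<^sub>R lgrad w r x"
    using Suc by (simp add: lessThan_Suc)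
  moreover have "lgrad w (Suc r) x = lgrad w r x + (2 / ((x - w r) \<bullet> (x - w r))) *\<^sub>R (x - w r)"
    by (simp add: lgrad_def)
  ultimately show ?case
    unfolding pgrad.simps pot.simps bdot_real sc by (simp only: scaleR_add_right scaleR_scaleR) simp
qed (simp add: lgrad_def)

text \<open>Differentiating \<open>P = exp f\<close> twice gives Hess P = P (grad f grad f^T + Hess
  f). The first term is a square, so a lower bound for the trace only needs Hess f.\<close>

lemma phess_eq:
  fixes x :: "real ^ 'n"
  assumes "x \<notin> w ` {..<r}"
  shows "h \<bullet> phess w r x h = pot w r x * ((lgrad w r x \<bullet> h)\<^sup>2
    + (\<Sum>i<r. 2 * (h \<bullet> h) / ((x - w i) \<bullet> (x - w i))
        - 4 * ((x - w i) \<bullet> h)\<^sup>2 / ((x - w i) \<bullet> (x - w i))\<^sup>2))"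
  using assms
proof (induction r)
  case (Suc r)
  define d where "d = x - w r"
  define q where "q = d \<bullet> d"
  define S where "S = (\<Sum>i<r. 2 * (h \<bullet> h) / ((x - w i) \<bullet> (x - w i))
        - 4 * ((x - w i) \<bullet> h)\<^sup>2 / ((x - w i) \<bullet> (x - w i))\<^sup>2)"
  have q: "q \<noteq> 0" using Suc.prems by (auto simp: q_def d_def lessThan_Suc)
  have nx: "x \<notin> w ` {..<r}" using Suc.prems by (auto simp: lessThan_Suc)
  have IH: "h \<bullet> phess w r x h = pot w r x * ((lgrad w r x \<bullet> h)\<^sup>2 + S)"
    using Suc.IH[OF nx] unfolding S_def .
  have g: "pgrad w r x = pot w r x *\<^sub>R lgrad w r x" by (rule pgrad_eq_lgrad[OF nx])
  have l: "lgrad w (Suc r) x = lgrad w r x + (2 / q) *\<^sub>R d"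
    by (simp add: lgrad_def q_def d_def)
  have sc: "c *s v = c *\<^sub>R v" for c and v :: "real ^ 'n" by (simp add: vec_eq_iff)
  have "h \<bullet> phess w (Suc r) x h = q * (h \<bullet> phess w r x h)
      + 4 * (d \<bullet> h) * (pot w r x * (lgrad w r x \<bullet> h)) + 2 * pot w r x * (h \<bullet> h)"
    unfolding phess.simps d_def[symmetric] bdot_real q_def[symmetric] sc g
    by (simp add: inner_add_right inner_commute)
  also have "\<dots> = q * pot w r x * ((lgrad w r x \<bullet> h + 2 / q * (d \<bullet> h))\<^sup>2 + S
      + 2 * (h \<bullet> h) / q - 4 * (d \<bullet> h)\<^sup>2 / q\<^sup>2)"
    unfolding IH using q by (simp add: field_simps power2_eq_square)
  also have "\<dots> = pot w (Suc r) x * ((lgrad w (Suc r) x \<bullet> h)\<^sup>2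
    + (\<Sum>i<Suc r. 2 * (h \<bullet> h) / ((x - w i) \<bullet> (x - w i))
        - 4 * ((x - w i) \<bullet> h)\<^sup>2 / ((x - w i) \<bullet> (x - w i))\<^sup>2))"
    unfolding l by (simp add: inner_add_left S_def bdot_real q_def d_def add_ac)
  finally show ?case .
qed (simp add: lgrad_def)

text \<open>Distinctness makes exactly one factor of \<open>P\<close> vanish at \<open>w m\<close>,
  and it vanishes quadratically. This covers the points that \<open>phess_eq\<close> has to leave
  out.\<close>

lemma jet_at_pole:
  fixes w :: "nat \<Rightarrow> real ^ 'n"
  assumes "inj_on w {..<r}" "m < r"
  shows "pot w r (w m) = 0 \<and> pgrad w r (w m) = 0 \<and> (\<exists>c>0. \<forall>h. phess w r (w m) h = c *\<^sub>R h)"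
  using assms
proof (induction r)
  case (Suc r)
  have sc: "c *s v = c *\<^sub>R v" for c and v :: "real ^ 'n" by (simp add: vec_eq_iff)
  show ?case
  proof (cases "m = r")
    case True
    have "w r \<notin> w ` {..<r}"
      using inj_on_eq_iff[OF Suc.prems(1)] by fastforce
    from pot_pos[OF this] show ?thesis
      by (auto simp: True bdot_real sc intro!: exI[of _ "2 * pot w r (w r)"])
  next
    case False
    then have "m < r" using Suc.prems by simp
    moreover have "inj_on w {..<r}" using Suc.prems by (auto simp: inj_on_def)
    ultimately obtain c where c: "pot w r (w m) = 0" "pgrad w r (w m) = 0" "c > 0"
      "\<And>h. phess w r (w m) h = c *\<^sub>R h" using Suc.IH by blast
    have "w m \<noteq> w r" using Suc.prems False by (auto simp: inj_on_def)
    then show ?thesis using c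
      by (auto simp: bdot_real sc intro!: exI[of _ "((w m - w r) \<bullet> (w m - w r)) * c"])
  qed
qed simp

lemma logpot_has_derivative:
  fixes x :: "real ^ 'n"
  assumes "x \<notin> w ` {..<r}"
  shows "(logpot w r has_derivative (\<lambda>h. lgrad w r x \<bullet> h)) (at x)"
proof -
  have "((\<lambda>x. \<Sum>i<r. ln ((x - w i) \<bullet> (x - w i))) has_derivative
      (\<lambda>h. \<Sum>i<r. (2 / ((x - w i) \<bullet> (x - w i))) *\<^sub>R (x - w i) \<bullet> h)) (at x)"
  proof (rule has_derivative_sum)
    fix i assume "i \<in> {..<r}"
    then have "x - w i \<noteq> 0" using assms by auto
    then show "((\<lambda>x. ln ((x - w i) \<bullet> (x - w i))) has_derivative
        (\<lambda>h. (2 / ((x - w i) \<bullet> (x - w i))) *\<^sub>R (x - w i) \<bullet> h)) (at x)"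
      by (auto intro!: derivative_eq_intros simp: inner_commute divide_simps)
  qed
  then show ?thesis
    by (simp add: logpot_def[abs_def] lgrad_def inner_sum_left power2_norm_eq_inner)
qed

lemma crit_points_lgrad:
  assumes "x \<in> crit_points w r"
  shows "x \<notin> w ` {..<r}" "lgrad w r x = 0"
proof -
  show x: "x \<notin> w ` {..<r}" using assms by (simp add: crit_points_def)
  have "(logpot w r has_derivative (\<lambda>h. 0)) (at x)" using assms by (simp add: crit_points_def)
  from has_derivative_unique[OF logpot_has_derivative[OF x] this]
  have "lgrad w r x \<bullet> lgrad w r x = 0" by (rule fun_cong)
  then show "lgrad w r x = 0" by simp
qed

lemma crit_points_pgrad: "x \<in> crit_points w r \<Longrightarrow> pgrad w r x = 0"
  by (simp add: pgrad_eq_lgrad crit_points_lgrad)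

text \<open>Outside a ball containing all \<open>w i\<close>, every \<open>x - w i\<close> makes an
  acute angle with \<open>x\<close>. This confines the zeros of the gradient and makes descent point
  inwards there.\<close>

lemma lgrad_outward:
  fixes w :: "nat \<Rightarrow> real ^ 'n"
  assumes "r \<ge> 1" "\<And>i. i < r \<Longrightarrow> norm (w i) < R" "norm x \<ge> R"
  shows "x \<notin> w ` {..<r}" "0 < x \<bullet> lgrad w r x"
proof -
  show "x \<notin> w ` {..<r}" using assms by force
  have d: "0 < x \<bullet> (x - w i)" "x - w i \<noteq> 0" if "i < r" for i
  proof -
    have "x \<bullet> w i \<le> norm x * norm (w i)" by (rule norm_cauchy_schwarz)
    also have "\<dots> < norm x * norm x"
      using assms(2)[OF that] assms(3) norm_ge_zero[of "w i"] 
      by (intro mult_strict_left_mono) linarith+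
    finally show "0 < x \<bullet> (x - w i)" by (simp add: inner_diff_right dot_square_norm power2_eq_square)
    then show "x - w i \<noteq> 0" by auto
  qed
  have "0 < (\<Sum>i<r. (2 / ((x - w i) \<bullet> (x - w i))) * (x \<bullet> (x - w i)))"
    using assms(1) d by (intro sum_pos) (auto intro!: mult_pos_pos divide_pos_pos simp: lessThan_empty_iff)
  then show "0 < x \<bullet> lgrad w r x" by (simp add: lgrad_def inner_sum_right)
qed

lemma bessel_two:
  fixes a b d :: "'a::real_inner"
  assumes "norm a = 1" "norm b = 1" "a \<bullet> b = 0"
  shows "(norm (d - (d \<bullet> a) *\<^sub>R a - (d \<bullet> b) *\<^sub>R b))\<^sup>2 = d \<bullet> d - (d \<bullet> a)\<^sup>2 - (d \<bullet> b)\<^sup>2"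
proof -
  have "a \<bullet> a = 1" "b \<bullet> b = 1" using assms by (simp_all add: dot_square_norm)
  then show ?thesis
    using assms(3) unfolding power2_norm_eq_inner
    by (simp add: inner_diff_left inner_diff_right inner_commute power2_eq_square)
qed

text \<open>On the plane spanned by \<open>a\<close> and \<open>b\<close> the Hessian of log |d|^2
  has trace 4 |d'|^2 / |d|^4, where d' is the component of d orthogonal to the plane. A nonpositive
  trace for \<open>P\<close> at \<open>x\<close> forces d' = 0 for every d = x - w i.\<close>

lemma strictly_two_convex_or_planar:
  fixes w :: "nat \<Rightarrow> real ^ 'n"
  assumes "inj_on w {..<r}" "\<not> strictly_two_convex w r"
  obtains x a b where "norm a = 1" "norm b = 1" "a \<bullet> b = 0"
    "\<And>i. i < r \<Longrightarrow> w i - x = ((w i - x) \<bullet> a) *\<^sub>R a + ((w i - x) \<bullet> b) *\<^sub>R b"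
proof -
  obtain x a b where ab: "norm a = 1" "norm b = 1" "a \<bullet> b = 0"
    and le: "a \<bullet> phess w r x a + b \<bullet> phess w r x b \<le> 0"
    using assms(2) unfolding strictly_two_convex_def not_all not_imp not_less by blast
  have ab1: "a \<bullet> a = 1" "b \<bullet> b = 1" using ab by (simp_all add: dot_square_norm)
  have x: "x \<notin> w ` {..<r}"
  proof
    assume "x \<in> w ` {..<r}"
    then obtain c where "c > 0" "\<forall>h. phess w r x h = c *\<^sub>R h"
      using jet_at_pole[OF assms(1)] by blast
    then show False using le ab1 by simp
  qed
  define t where "t i = (norm ((x - w i) - ((x - w i) \<bullet> a) *\<^sub>R a - ((x - w i) \<bullet> b) *\<^sub>R b))\<^sup>2" for i
  define q where "q i = (x - w i) \<bullet> (x - w i)" for i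
  have q: "q i > 0" if "i < r" for i using that x by (auto simp: q_def)
  have "a \<bullet> phess w r x a + b \<bullet> phess w r x b
    = pot w r x * ((lgrad w r x \<bullet> a)\<^sup>2 + (lgrad w r x \<bullet> b)\<^sup>2 + (\<Sum>i<r. 4 * t i / (q i)\<^sup>2))"
  proof -
    have "(\<Sum>i<r. 4 * t i / (q i)\<^sup>2)
      = (\<Sum>i<r. 2 / q i - 4 * ((x - w i) \<bullet> a)\<^sup>2 / (q i)\<^sup>2)
        + (\<Sum>i<r. 2 / q i - 4 * ((x - w i) \<bullet> b)\<^sup>2 / (q i)\<^sup>2)"
      unfolding sum.distrib[symmetric]
    proof (rule sum.cong)
      fix i assume "i \<in> {..<r}"
      then have "q i \<noteq> 0" using q by force
      then show "4 * t i / (q i)\<^sup>2 = 2 / q i - 4 * ((x - w i) \<bullet> a)\<^sup>2 / (q i)\<^sup>2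
        + (2 / q i - 4 * ((x - w i) \<bullet> b)\<^sup>2 / (q i)\<^sup>2)"
        unfolding t_def bessel_two[OF ab] q_def[symmetric]
        by (simp add: field_simps power2_eq_square)
    qed simp
    then show ?thesis
      unfolding phess_eq[OF x] ab1 q_def[symmetric] by (simp add: algebra_simps)
  qed
  with le pot_pos[OF x]
  have "(lgrad w r x \<bullet> a)\<^sup>2 + (lgrad w r x \<bullet> b)\<^sup>2 + (\<Sum>i<r. 4 * t i / (q i)\<^sup>2) \<le> 0"
    by (simp add: mult_le_0_iff)
  moreover have tn: "0 \<le> 4 * t i / (q i)\<^sup>2" for i by (simp add: t_def)
  ultimately have "(\<Sum>i<r. 4 * t i / (q i)\<^sup>2) = 0"
    by (smt (verit, best) sum_nonneg zero_le_power2)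
  then have "t i = 0" if "i < r" for i
    using that q[OF that] tn by (subst (asm) sum_nonneg_eq_0_iff) auto
  then have "(x - w i) = ((x - w i) \<bullet> a) *\<^sub>R a + ((x - w i) \<bullet> b) *\<^sub>R b" if "i < r" for i
    using that by (simp add: t_def algebra_simps)
  then have "w i - x = ((w i - x) \<bullet> a) *\<^sub>R a + ((w i - x) \<bullet> b) *\<^sub>R b" if "i < r" for i
  proof -
    have "w i - x = - (((x - w i) \<bullet> a) *\<^sub>R a + ((x - w i) \<bullet> b) *\<^sub>R b)"
      using \<open>\<And>i. i < r \<Longrightarrow> x - w i = _\<close>[OF that] by (metis minus_diff_eq)
    also have "\<dots> = ((w i - x) \<bullet> a) *\<^sub>R a + ((w i - x) \<bullet> b) *\<^sub>R b"
      by (simp add: inner_diff_left algebra_simps)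
    finally show ?thesis .
  qed
  with ab show thesis by (rule that)
qed

section \<open>Planar configurations\<close>

lemma finite_zeros_sum_inverse:
  fixes z :: "nat \<Rightarrow> complex"
  assumes "r \<ge> 1" "inj_on z {..<r}"
  shows "finite {u. u \<notin> z ` {..<r} \<and> (\<Sum>i<r. inverse (u - z i)) = 0}"
proof -
  \<comment> \<open>This is the derivative of the product of all X - z j, hence the numerator of the
    sum of inverses.\<close>
  define p where "p = (\<Sum>i<r. \<Prod>j\<in>{..<r} - {i}. [:- z j, 1:])"
  have pp: "poly p u = (\<Sum>i<r. \<Prod>j\<in>{..<r} - {i}. (u - z j))" for u
    by (simp add: p_def poly_sum poly_prod)
  \<comment> \<open>At \<open>z 0\<close> only the summand that omits the factor X - z 0 survives,
    and distinctness makes it nonzero. So \<open>p\<close> is not the zero polynomial.\<close>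
  have "poly p (z 0) = (\<Prod>j\<in>{..<r} - {0}. (z 0 - z j)) +
     (\<Sum>i\<in>{..<r} - {0}. \<Prod>j\<in>{..<r} - {i}. (z 0 - z j))"
    unfolding pp using assms(1) by (subst sum.remove[of _ 0]) auto
  also have "(\<Sum>i\<in>{..<r} - {0}. \<Prod>j\<in>{..<r} - {i}. (z 0 - z j)) = 0"
    using assms(1) by (intro sum.neutral ballI prod_zero) (auto intro!: bexI[of _ 0])
  also have "(\<Prod>j\<in>{..<r} - {0}. (z 0 - z j)) + 0 \<noteq> 0"
    using assms by (auto simp: inj_on_def)
  finally have "p \<noteq> 0" by auto
  moreover have "poly p u = 0" if "u \<notin> z ` {..<r}" "(\<Sum>i<r. inverse (u - z i)) = 0" for u
  proof -
    have "poly p u = (\<Sum>i<r. (\<Prod>j<r. (u - z j)) * inverse (u - z i))"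
      unfolding pp
    proof (rule sum.cong)
      fix i assume i: "i \<in> {..<r}"
      then have "(\<Prod>j<r. (u - z j)) = (u - z i) * (\<Prod>j\<in>{..<r} - {i}. (u - z j))"
        by (intro prod.remove) auto
      moreover have "u - z i \<noteq> 0" using i that(1) by auto
      ultimately show "(\<Prod>j\<in>{..<r} - {i}. (u - z j)) = (\<Prod>j<r. (u - z j)) * inverse (u - z i)"
        by (simp add: field_simps)
    qed simp
    then show ?thesis using that(2) by (simp add: sum_distrib_left[symmetric])
  qed
  ultimately show ?thesis
    by (intro finite_subset[OF _ poly_roots_finite[of p]]) auto
qed

text \<open>The factor is left as \<open>2 / t / 2\<close> to match half of the weight 2 / |x - w
  i|^2 in the gradient.\<close>

lemma inverse_Complex_eq:
  "t = s\<^sup>2 + u\<^sup>2 \<Longrightarrow> inverse (Complex s u) = cnj (of_real (2 / t / 2) * Complex s u)"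
  using mult_divide_mult_cancel_left[of 2 s t] mult_divide_mult_cancel_left[of 2 u t] by (simp add: complex_eq_iff mult.commute)

text \<open>As in the Gauss-Lucas theorem, a critical point is a weighted mean of the
  \<open>w i\<close> with positive weights, so it lies in their plane. In the complex coordinate
  \<open>Z\<close> of that plane the gradient of \<open>f\<close> is twice the conjugate of the sum
  of inverses, and \<open>Z\<close> is injective there.\<close>

lemma finite_crit_points_planar:
  fixes w :: "nat \<Rightarrow> real ^ 'n"
  assumes r: "r \<ge> 1" "inj_on w {..<r}" and ab: "norm a = 1" "norm b = 1" "a \<bullet> b = 0"
    and pl: "\<And>i. i < r \<Longrightarrow> w i - c = ((w i - c) \<bullet> a) *\<^sub>R a + ((w i - c) \<bullet> b) *\<^sub>R b"
  shows "finite (crit_points w r)"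
proof -
  define Z where "Z x = Complex ((x - c) \<bullet> a) ((x - c) \<bullet> b)" for x
  define z where "z i = Z (w i)" for i
  have ab1: "a \<bullet> a = 1" "b \<bullet> b = 1" "b \<bullet> a = 0"
    using ab by (simp_all add: dot_square_norm inner_commute)
  define V where "V = {x. x - c = ((x - c) \<bullet> a) *\<^sub>R a + ((x - c) \<bullet> b) *\<^sub>R b}"
  have wV: "w i \<in> V" if "i < r" for i using pl[OF that] by (simp add: V_def)
  have injZ: "inj_on Z V"
  proof (rule inj_onI)
    fix x y assume xy: "x \<in> V" "y \<in> V" "Z x = Z y"
    then have "(x - c) \<bullet> a = (y - c) \<bullet> a" "(x - c) \<bullet> b = (y - c) \<bullet> b"
      by (simp_all add: Z_def)
    then have "x - c = y - c" using xy(1,2) unfolding V_def mem_Collect_eq by metis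
    then show "x = y" by simp
  qed
  have "inj_on z {..<r}"
    unfolding z_def using inj_on_eq_iff[OF r(2)] inj_on_eq_iff[OF injZ] wV
    by (intro inj_onI) (metis lessThan_iff)
  note fin = finite_zeros_sum_inverse[OF r(1) this]
  have cr: "x \<in> V \<and> Z x \<notin> z ` {..<r} \<and> (\<Sum>i<r. inverse (Z x - z i)) = 0"
    if "x \<in> crit_points w r" for x
  proof -
    note x = crit_points_lgrad[OF that]
    define l where "l i = 2 / ((x - w i) \<bullet> (x - w i))" for i
    have l: "l i > 0" if "i < r" for i using that x(1) by (auto simp: l_def)
    have s0: "(\<Sum>i<r. l i *\<^sub>R (x - w i)) = 0" using x(2) by (simp add: lgrad_def l_def)
    define L where "L = (\<Sum>i<r. l i)"
    have L: "L > 0" unfolding L_def using r(1) l by (intro sum_pos) (auto simp: lessThan_empty_iff)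
    have Lx: "L *\<^sub>R (x - c) = (\<Sum>i<r. l i *\<^sub>R (w i - c))"
    proof -
      have "(\<Sum>i<r. l i *\<^sub>R (x - c)) - (\<Sum>i<r. l i *\<^sub>R (w i - c)) = (\<Sum>i<r. l i *\<^sub>R (x - w i))"
        unfolding sum_subtractf[symmetric] by (simp add: algebra_simps)
      then show ?thesis using s0 by (simp add: L_def scaleR_sum_left)
    qed
    have "L *\<^sub>R (x - c) = L *\<^sub>R (((x - c) \<bullet> a) *\<^sub>R a + ((x - c) \<bullet> b) *\<^sub>R b)"
    proof -
      have "L *\<^sub>R (x - c) = (\<Sum>i<r. l i *\<^sub>R (((w i - c) \<bullet> a) *\<^sub>R a + ((w i - c) \<bullet> b) *\<^sub>R b))"
        unfolding Lx using pl by (intro sum.cong) auto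
      also have "\<dots> = ((\<Sum>i<r. l i *\<^sub>R (w i - c)) \<bullet> a) *\<^sub>R a + ((\<Sum>i<r. l i *\<^sub>R (w i - c)) \<bullet> b) *\<^sub>R b"
        by (simp add: inner_sum_left scaleR_sum_left scaleR_add_right sum.distrib)
      finally show ?thesis unfolding Lx[symmetric] by (simp add: scaleR_add_right)
    qed
    then have xV: "x \<in> V" using L by (simp add: V_def)
    have "Z x \<notin> z ` {..<r}"
    proof
      assume "Z x \<in> z ` {..<r}"
      then obtain i where "i < r" "Z x = Z (w i)" by (auto simp: z_def)
      then have "x = w i" using inj_onD[OF injZ] xV wV by blast
      then show False using x(1) \<open>i < r\<close> by blast
    qed
    moreover have "(\<Sum>i<r. inverse (Z x - z i)) = 0"
    proof -
      have inv: "inverse (Z x - z i) = cnj (of_real (l i / 2) * (Z x - z i))" if "i < r" for i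
      proof -
        have d: "x - w i = ((x - w i) \<bullet> a) *\<^sub>R a + ((x - w i) \<bullet> b) *\<^sub>R b"
        proof -
          have "x - w i = (x - c) - (w i - c)" by simp
          also have "\<dots> = (((x - c) \<bullet> a) *\<^sub>R a + ((x - c) \<bullet> b) *\<^sub>R b) - 
              (((w i - c) \<bullet> a) *\<^sub>R a + ((w i - c) \<bullet> b) *\<^sub>R b)"
            by (rule arg_cong2[where f = "(-)", OF xV[unfolded V_def mem_Collect_eq] pl[OF that]])
          also have "\<dots> = ((x - w i) \<bullet> a) *\<^sub>R a + ((x - w i) \<bullet> b) *\<^sub>R b"
            by (simp add: algebra_simps)
          finally show ?thesis .
        qed
        have zz: "Z x - z i = Complex ((x - w i) \<bullet> a) ((x - w i) \<bullet> b)"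
          by (simp add: Z_def z_def complex_eq_iff inner_diff_left)
        have "(x - w i) \<bullet> (x - w i) = ((x - w i) \<bullet> a)\<^sup>2 + ((x - w i) \<bullet> b)\<^sup>2"
        proof -
          have "x - w i - ((x - w i) \<bullet> a) *\<^sub>R a - ((x - w i) \<bullet> b) *\<^sub>R b = 0"
            unfolding diff_diff_eq[of "x - w i"] by (rule eq_iff_diff_eq_0[THEN iffD1, OF d])
          with bessel_two[OF ab, of "x - w i"] show ?thesis by simp
        qed
        then show ?thesis unfolding zz l_def by (rule inverse_Complex_eq)
      qed
      have "(\<Sum>i<r. of_real (l i / 2) * (Z x - z i)) =
          Complex ((\<Sum>i<r. l i *\<^sub>R (x - w i)) \<bullet> a / 2) ((\<Sum>i<r. l i *\<^sub>R (x - w i)) \<bullet> b / 2)"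
        by (simp add: complex_eq_iff Z_def z_def inner_sum_left sum_divide_distrib inner_diff_left)
      also have "\<dots> = 0" using s0 by (simp add: complex_eq_iff)
      finally have "cnj (\<Sum>i<r. of_real (l i / 2) * (Z x - z i)) = 0" by simp
      moreover have "(\<Sum>i<r. inverse (Z x - z i)) = (\<Sum>i<r. cnj (of_real (l i / 2) * (Z x - z i)))"
        by (rule sum.cong[OF refl], rule inv) simp
      ultimately show ?thesis unfolding cnj_sum by (rule trans[rotated])
    qed
    ultimately show ?thesis by (intro conjI xV)
  qed
  have "Z ` crit_points w r \<subseteq> {u. u \<notin> z ` {..<r} \<and> (\<Sum>i<r. inverse (u - z i)) = 0}"
  proof
    fix u assume "u \<in> Z ` crit_points w r"
    then obtain x where x: "u = Z x" "x \<in> crit_points w r" by blast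
    show "u \<in> {u. u \<notin> z ` {..<r} \<and> (\<Sum>i<r. inverse (u - z i)) = 0}"
      unfolding x(1) using cr[OF x(2)] by simp
  qed
  then have "finite (Z ` crit_points w r)" using fin by (rule finite_subset)
  moreover have "inj_on Z (crit_points w r)"
    by (rule inj_on_subset[OF injZ], rule subsetI, erule conjunct1[OF cr])
  ultimately show ?thesis by (rule finite_imageD)
qed

subsection \<open>Arcs of critical points\<close>

definition cvec :: "real ^ 'n \<Rightarrow> complex ^ 'n" where "cvec x = (\<chi> i. complex_of_real (x $ i))"
definition vRe :: "complex ^ 'n \<Rightarrow> real ^ 'n" where "vRe z = (\<chi> i. Re (z $ i))"
definition vIm :: "complex ^ 'n \<Rightarrow> real ^ 'n" where "vIm z = (\<chi> i. Im (z $ i))"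
definition vcnj :: "complex ^ 'n \<Rightarrow> complex ^ 'n" where "vcnj z = (\<chi> i. cnj (z $ i))"

lemma cvec_simps:
  "cvec (x + y) = cvec x + cvec y" "cvec (x - y) = cvec x - cvec y"
  "cvec (c *s x) = of_real c *s cvec x" "cvec 0 = 0"
  "cvec x = cvec y \<longleftrightarrow> x = y" "vRe (cvec x) = x" "vIm (cvec x) = 0" "vcnj (cvec x) = cvec x"
  by (simp_all add: cvec_def vRe_def vIm_def vcnj_def vec_eq_iff)

lemma vRe_simps:
  "vRe (x + y) = vRe x + vRe y" "vRe (of_real c *s x) = c *s vRe x" "vRe 0 = 0"
  "vIm (x + y) = vIm x + vIm y" "vIm (of_real c *s x) = c *s vIm x" "vIm 0 = 0"
  by (simp_all add: vRe_def vIm_def vec_eq_iff)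

lemma vRe_smult_cvec: "vRe (c *s cvec x) = Re c *s x" "vIm (c *s cvec x) = Im c *s x"
  by (simp_all add: cvec_def vRe_def vIm_def vec_eq_iff)

lemma vec_eq_vRe_vIm: "z = 0 \<longleftrightarrow> vRe z = 0 \<and> vIm z = 0"
  by (auto simp: vRe_def vIm_def vec_eq_iff complex_eq_iff)

lemma vcnj_simps:
  "vcnj (x + y) = vcnj x + vcnj y" "vcnj (x - y) = vcnj x - vcnj y"
  "vcnj (c *s x) = cnj c *s vcnj x" "vcnj 0 = 0"
  by (simp_all add: vcnj_def vec_eq_iff)

lemma cvec_vRe: "vcnj z = z \<Longrightarrow> cvec (vRe z) = z"
  unfolding vcnj_def cvec_def vRe_def vec_eq_iff by (simp add: complex_eq_iff)

lemma norm_cvec: "norm (cvec x) = norm x"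
  by (simp add: norm_vec_def cvec_def)

lemma bdot_cvec: "bdot (cvec x) (cvec y) = of_real (bdot x y)"
  by (simp add: bdot_def cvec_def)

lemma Re_bdot_cvec: "Re (bdot (cvec x) z) = bdot x (vRe z)" "Im (bdot (cvec x) z) = bdot x (vIm z)"
  by (simp_all add: bdot_def cvec_def vRe_def vIm_def)

lemma bdot_vcnj: "bdot (vcnj x) (vcnj y) = cnj (bdot x y)"
  by (simp add: bdot_def vcnj_def cnj_sum)

lemma pot_cvec: "pot (\<lambda>i. cvec (w i)) r (cvec x) = of_real (pot w r x)"
  by (induction r) (simp_all add: bdot_cvec cvec_simps(2)[symmetric])

lemma pgrad_cvec: "pgrad (\<lambda>i. cvec (w i)) r (cvec x) = cvec (pgrad w r x)"
proof (induction r)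
  case (Suc r)
  have d: "cvec x - cvec (w r) = cvec (x - w r)" by (simp add: cvec_simps)
  have two: "2 * complex_of_real t = complex_of_real (2 * t)" for t by simp
  show ?case
    unfolding pgrad.simps d pot_cvec bdot_cvec Suc two cvec_simps(1,3) ..
qed (simp add: cvec_simps)

text \<open>At a real point the complexified Hessian acts on real and imaginary parts separately, so
  its invertibility reduces to the real case.\<close>

lemma vRe_phess:
  "vRe (phess (\<lambda>i. cvec (w i)) r (cvec x) h) = phess w r x (vRe h)"
  "vIm (phess (\<lambda>i. cvec (w i)) r (cvec x) h) = phess w r x (vIm h)"
proof (induction r)
  case (Suc r)
  have two: "2 * complex_of_real t = complex_of_real (2 * t)" for t by simp
  have d: "cvec x - cvec (w r) = cvec (x - w r)" by (simp add: cvec_simps)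
  case 1
  show ?case
    unfolding phess.simps vRe_simps pot_cvec pgrad_cvec d bdot_cvec
      vRe_smult_cvec two using Suc(1) by (simp add: Re_bdot_cvec)
  case 2
  show ?case
    unfolding phess.simps vRe_simps pot_cvec pgrad_cvec d bdot_cvec
      vRe_smult_cvec two using Suc(2) by (simp add: Re_bdot_cvec)
qed (simp_all add: vRe_simps)

lemma pot_vcnj: "pot (\<lambda>i. cvec (w i)) r (vcnj z) = cnj (pot (\<lambda>i. cvec (w i)) r z)"
proof (induction r)
  case (Suc r)
  have "vcnj z - cvec (w r) = vcnj (z - cvec (w r))" by (simp add: vcnj_simps cvec_simps)
  with Suc show ?case by (simp add: bdot_vcnj)
qed simp

text \<open>The coefficients are real. Combined with uniqueness of preimages, this symmetry will
  show that the complex curve consists of real points at real parameters.\<close>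

lemma pgrad_vcnj: "pgrad (\<lambda>i. cvec (w i)) r (vcnj z) = vcnj (pgrad (\<lambda>i. cvec (w i)) r z)"
proof (induction r)
  case (Suc r)
  have d: "vcnj z - cvec (w r) = vcnj (z - cvec (w r))" by (simp add: vcnj_simps cvec_simps)
  show ?case
    unfolding pgrad.simps d pot_vcnj bdot_vcnj Suc vcnj_simps(1,3) by simp
qed (simp add: vcnj_simps)

section \<open>Degenerate zeros of the gradient\<close>

lemma closed_pgrad_zeros: "closed {x. pgrad w r x = 0}"
  by (intro closed_Collect_eq continuous_intros)

text \<open>An injective Hessian satisfies |H u| >= B |u|, while a zero \<open>y\<close> of the
  gradient close to \<open>p\<close> gives |H (y - p)| <= B/2 |y - p| by first-order expansion. So
  \<open>p\<close> would be isolated.\<close>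

lemma limpt_pgrad_zeros_kernel:
  fixes w :: "nat \<Rightarrow> real ^ 'n"
  assumes "p islimpt {x. pgrad w r x = 0}"
  obtains k where "norm k = 1" "phess w r p k = 0"
proof -
  have p: "pgrad w r p = 0" using closed_pgrad_zeros assms closed_limpt by blast
  have "\<not> inj (phess w r p)"
  proof
    assume inj: "inj (phess w r p)"
    have lin: "linear (phess w r p)" by (rule bounded_linear.linear[OF bounded_linear_phess])
    obtain B where B: "B > 0" "\<And>x. B * norm x \<le> norm (phess w r p x)"
      by (rule linear_inj_bounded_below_pos[OF lin inj]) blast
    from pgrad_has_derivative[of w r p, unfolded has_derivative_at_alt] B(1)
    obtain d where d: "d > 0" "\<And>y. norm (y - p) < d \<Longrightarrow>
        norm (pgrad w r y - pgrad w r p - phess w r p (y - p)) \<le> B / 2 * norm (y - p)"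
      by (meson half_gt_zero)
    obtain y where y: "pgrad w r y = 0" "y \<noteq> p" "norm (y - p) < d"
      using assms d(1) by (auto simp: islimpt_approachable dist_norm)
    have "norm (phess w r p (y - p)) \<le> B / 2 * norm (y - p)"
      using d(2)[OF y(3)] p y(1) by simp
    with B(2)[of "y - p"] have "B * norm (y - p) \<le> B / 2 * norm (y - p)" by linarith
    then show False using B(1) y(2) by (simp add: mult_le_cancel_right)
  qed
  then obtain u where u: "u \<noteq> 0" "phess w r p u = 0"
    using linear_injective_0[OF bounded_linear.linear[OF bounded_linear_phess]] by blast
  interpret bounded_linear "phess w r p" by (rule bounded_linear_phess)
  show thesis
    by (rule that[of "(1 / norm u) *\<^sub>R u"]) (use u in \<open>simp_all add: scaleR\<close>)
qed

text \<open>Two orthonormal kernel vectors would span a plane on which the Hessian has trace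
  0.\<close>

lemma kernel_line:
  fixes w :: "nat \<Rightarrow> real ^ 'n"
  assumes "strictly_two_convex w r" "norm k = 1" "phess w r p k = 0" "phess w r p u = 0" "k \<bullet> u = 0"
  shows "u = 0"
proof (rule ccontr)
  assume u: "u \<noteq> 0"
  interpret bounded_linear "phess w r p" by (rule bounded_linear_phess)
  define v where "v = (1 / norm u) *\<^sub>R u"
  have "norm v = 1" "k \<bullet> v = 0" "phess w r p v = 0" using u assms by (simp_all add: v_def scaleR)
  with assms(1)[unfolded strictly_two_convex_def, rule_format, of k v p] assms(2,3)
  show False by simp
qed

text \<open>
  The implicit function theorem is applied to the complexified gradient, made invertible by the
  rank one term \<open>k k\<^sup>T (z - p)\<close>. The component of the gradient along \<open>k\<close> is then
  a holomorphic function on the resulting curve, and the identity theorem makes it vanish.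
\<close>

lemma critical_arc:
  fixes w :: "nat \<Rightarrow> real ^ 'n" and r :: nat and p :: "real ^ 'n"
  defines "Z \<equiv> {x. pgrad w r x = 0}"
  assumes stc: "strictly_two_convex w r" and lim: "p islimpt Z"
  obtains k \<alpha> \<delta> where "\<delta> > 0" "norm k = 1"
    "\<And>s. \<bar>s\<bar> < \<delta> \<Longrightarrow> \<alpha> s islimpt Z \<and> k \<bullet> (\<alpha> s - p) = s
        \<and> (\<exists>v. (\<alpha> has_vector_derivative v) (at s) \<and> norm v \<le> 11 / 10)"
    "\<And>x. x \<in> Z \<Longrightarrow> norm (x - p) < \<delta> \<Longrightarrow> x = \<alpha> (k \<bullet> (x - p))"
proof -
  obtain k where k: "norm k = 1" "phess w r p k = 0"
    using limpt_pgrad_zeros_kernel lim unfolding Z_def by blast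
  have kk: "k \<bullet> k = 1" using k(1) by (simp add: dot_square_norm)
  have p: "pgrad w r p = 0" using closed_pgrad_zeros lim closed_limpt unfolding Z_def by blast
  define W where "W i = cvec (w i)" for i
  have W: "W = (\<lambda>i. cvec (w i))" by (simp add: W_def fun_eq_iff)
  define F where "F z = pgrad W r z + bdot (cvec k) (z - cvec p) *s cvec k" for z
  define F' where "F' z h = phess W r z h + bdot (cvec k) h *s cvec k" for z h
  have F_der: "(F has_derivative F' z) (at z)" for z
  proof -
    have "((\<lambda>z. bdot (cvec k) (z - cvec p)) has_derivative bdot (cvec k)) (at z)"
      by (rule has_derivative_eq_rhs[OF bounded_linear.has_derivative[OF bdot.bounded_linear_right]])
        (auto intro!: derivative_eq_intros)
    then show ?thesis unfolding F_def[abs_def] F'_def[abs_def]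
      by (intro has_derivative_add pgrad_has_derivative
          bounded_linear.has_derivative[OF vsm.bounded_linear_left])
  qed
  have F'_lin: "bounded_linear (F' z)" for z using has_derivative_bounded_linear[OF F_der] .
  have F'_smult: "F' z (c *s h) = c *s F' z h" for z c h
    by (simp add: F'_def phess_smult bdot_smult_right vec_eq_iff algebra_simps)
  have F_real: "F (cvec x) = cvec (pgrad w r x) + of_real (k \<bullet> (x - p)) *s cvec k" for x
    by (simp add: F_def W pgrad_cvec cvec_simps(2)[symmetric] bdot_cvec bdot_real)
  have F_p: "F (cvec p) = 0" by (simp add: F_real p cvec_simps)
  have F_vcnj: "F (vcnj z) = vcnj (F z)" for z
  proof -
    have "bdot (cvec k) (vcnj z - cvec p) = bdot (vcnj (cvec k)) (vcnj (z - cvec p))"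
      by (simp add: cvec_simps vcnj_simps)
    then show ?thesis unfolding F_def W pgrad_vcnj bdot_vcnj by (simp add: vcnj_simps cvec_simps)
  qed
  have inj: "inj (F' (cvec p))"
  proof -
    have "h = 0" if "F' (cvec p) h = 0" for h
    proof -
      \<comment> \<open>Pairing with \<open>k\<close> kills the Hessian term, since \<open>k\<close>
        is in the kernel of a symmetric map. So \<open>u\<close> is orthogonal to \<open>k\<close>
        and itself in the kernel.\<close>
      have *: "u = 0" if "phess w r p u + (k \<bullet> u) *s k = 0" for u
      proof -
        have "k \<bullet> phess w r p u = 0"
          using phess_sym[of w r p k u] k(2) by (simp add: bdot_real)
        moreover have "k \<bullet> (phess w r p u + (k \<bullet> u) *\<^sub>R k) = 0"
          using that by (simp add: scalar_mult_eq_scaleR)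
        ultimately have ku: "k \<bullet> u = 0" by (simp add: inner_add_right kk)
        with that have "phess w r p u = 0" by simp
        from kernel_line[OF stc k this ku] show ?thesis .
      qed
      have "vRe h = 0"
        using arg_cong[OF that, of vRe] unfolding F'_def W
        by - (rule *, simp add: vRe_simps vRe_phess vRe_smult_cvec Re_bdot_cvec bdot_real)
      moreover have "vIm h = 0"
        using arg_cong[OF that, of vIm] unfolding F'_def W
        by - (rule *, simp add: vRe_simps vRe_phess vRe_smult_cvec Re_bdot_cvec bdot_real)
      ultimately show ?thesis by (simp add: vec_eq_vRe_vIm)
    qed
    then show ?thesis
      using linear_injective_0[OF bounded_linear.linear[OF F'_lin]] by blast
  qed
  obtain g where g: "linear g" "g \<circ> F' (cvec p) = id"
    using linear_injective_left_inverse[OF bounded_linear.linear[OF F'_lin] inj] by blast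
  have contF': "continuous_on UNIV (\<lambda>z. Blinfun (F' z))"
    by (rule continuous_on_blinfun_componentwise)
      (auto simp: bounded_linear_Blinfun_apply[OF F'_lin] F'_def
        intro!: continuous_intros)
  have "Blinfun g o\<^sub>L Blinfun (F' (cvec p)) = id_blinfun"
    using g by (intro blinfun_eqI)
      (simp add: bounded_linear_Blinfun_apply[OF F'_lin] fun_eq_iff
        bounded_linear_Blinfun_apply[OF linear_conv_bounded_linear[THEN iffD1]])
  from inverse_function_theorem[OF open_UNIV _ contF' UNIV_I this, of F]
  obtain U V \<psi> \<psi>' where UV: "open U" "cvec p \<in> U" "open V" "F (cvec p) \<in> V" "homeomorphism U V F \<psi>"
    and der: "\<And>y. y \<in> V \<Longrightarrow> (\<psi> has_derivative \<psi>' y) (at y)"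
      "\<And>y. y \<in> V \<Longrightarrow> \<psi>' y = inv (F' (\<psi> y))" "\<And>y. y \<in> V \<Longrightarrow> bij (F' (\<psi> y))"
    unfolding bounded_linear_Blinfun_apply[OF F'_lin] using F_der by metis
  have inv1: "\<psi> (F z) = z" if "z \<in> U" for z using UV(5) that by (simp add: homeomorphism_def)
  have inv2: "F (\<psi> y) = y" if "y \<in> V" for y using UV(5) that by (simp add: homeomorphism_def)
  \<comment> \<open>At a real zero of the gradient, \<open>F\<close> is just a multiple of
    \<open>k\<close>. All such zeros near \<open>p\<close> therefore lie on this preimage of the
    complex line through \<open>k\<close>.\<close>
  define X where "X s = \<psi> (s *s cvec k)" for s
  obtain e where e: "e > 0" "ball 0 e \<subseteq> V" using UV(3,4) F_p open_contains_ball by metis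
  have inV: "s *s cvec k \<in> V" if "norm s < e" for s
    using e(2) that k(1) by (auto simp: subset_iff norm_vector_scalar_mult norm_cvec)
  have X0: "X 0 = cvec p" using inv1[OF UV(2)] F_p by (simp add: X_def)
  define D where "D s = \<psi>' (s *s cvec k) (cvec k)" for s
  have X_der: "((\<lambda>s. X s $ i) has_field_derivative D s $ i) (at s)" if "norm s < e" for s i
  proof -
    define y where "y = s *s cvec k"
    have y: "y \<in> V" using inV[OF that] by (simp add: y_def)
    \<comment> \<open>The inverse function theorem only yields a real derivative. Its value inherits
      complex linearity from \<open>F'\<close>, which makes the curve holomorphic.\<close>
    have hom: "\<psi>' y (c *s h) = c *s \<psi>' y h" for c h
    proof -
      have "F' (\<psi> y) (c *s \<psi>' y h) = c *s h"
        unfolding F'_smult using der(2,3)[OF y] by (simp add: bij_is_surj surj_f_inv_f)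
      then show ?thesis using der(2,3)[OF y] by (metis bij_inv_eq_iff)
    qed
    have "((\<lambda>s. \<psi> (s *s cvec k)) has_derivative (\<lambda>c. \<psi>' y (c *s cvec k))) (at s)"
      unfolding y_def
      by (rule has_derivative_compose[OF bounded_linear.has_derivative[OF vsm.bounded_linear_left has_derivative_ident]
        der(1)[OF y, unfolded y_def]])
    then have "((\<lambda>s. \<psi> (s *s cvec k) $ i) has_derivative (\<lambda>c. \<psi>' y (c *s cvec k) $ i)) (at s)"
      by (rule bounded_linear.has_derivative[OF bounded_linear_vec_nth])
    then show ?thesis
      unfolding X_def D_def has_field_derivative_def y_def[symmetric] hom
      by (rule has_derivative_eq_rhs) (simp add: fun_eq_iff mult.commute)
  qed
  have X_hol: "(\<lambda>s. X s $ i) holomorphic_on ball 0 e" for i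
    using X_der by (auto simp: holomorphic_on_def intro: field_differentiable_at_within
        simp: field_differentiable_def) (meson field_differentiable_at_within field_differentiable_def)
  define h where "h s = s - bdot (cvec k) (X s - cvec p)" for s
  have h_hol: "h holomorphic_on ball 0 e"
    unfolding h_def bdot_def by (auto intro!: holomorphic_intros X_hol)
  have FX: "pgrad W r (X s) = h s *s cvec k" if "norm s < e" for s
  proof -
    have "F (X s) = s *s cvec k" using inv2[OF inV[OF that]] by (simp add: X_def)
    then show ?thesis unfolding F_def h_def by (simp add: vec_eq_iff algebra_simps)
  qed
  have onX: "cvec x = X (of_real (k \<bullet> (x - p)))" if "pgrad w r x = 0" "cvec x \<in> U" for x
    using inv1[OF that(2)] that(1) by (simp add: F_real X_def cvec_simps)
  obtain d where d: "d > 0" "ball (cvec p) d \<subseteq> U" using UV(1,2) open_contains_ball by metis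
  have inU: "cvec x \<in> U" if "norm (x - p) < d" for x
    using d(2) that by (auto simp: subset_iff dist_norm cvec_simps(2)[symmetric] norm_cvec norm_minus_commute)
  have k_le: "\<bar>k \<bullet> u\<bar> \<le> norm u" for u using Cauchy_Schwarz_ineq2[of k u] k(1) by simp
  \<comment> \<open>Zeros of the gradient accumulating at \<open>p\<close> lie on the curve, and
    their parameters are zeros of \<open>h\<close> accumulating at 0.\<close>
  have h0: "h s = 0" if "norm s < e" for s
  proof (rule analytic_continuation[OF h_hol, of "{s. h s = 0 \<and> norm s < e}" 0])
    show "0 islimpt {s. h s = 0 \<and> norm s < e}"
      unfolding islimpt_approachable
    proof (intro allI impI)
      fix \<epsilon> :: real assume "\<epsilon> > 0"
      then have "Min {\<epsilon>, d, e} > 0" using d(1) e(1) by simp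
      then obtain x where "x \<in> Z" "x \<noteq> p" "dist x p < Min {\<epsilon>, d, e}"
        using lim[unfolded islimpt_approachable] by blast
      then have x: "pgrad w r x = 0" "x \<noteq> p" "norm (x - p) < Min {\<epsilon>, d, e}"
        by (simp_all add: Z_def dist_norm)
      define s where "s = complex_of_real (k \<bullet> (x - p))"
      have Xs: "X s = cvec x" using onX[OF x(1) inU] x(3) by (simp add: s_def)
      have "h s = 0" unfolding h_def Xs
        by (simp add: cvec_simps(2)[symmetric] bdot_cvec bdot_real s_def)
      moreover have "s \<noteq> 0" using Xs X0 x(2) by (auto simp: cvec_simps)
      moreover have "norm s < \<epsilon>" "norm s < e" using k_le[of "x - p"] x(3) by (simp_all add: s_def)
      ultimately show "\<exists>s\<in>{s. h s = 0 \<and> norm s < e}. s \<noteq> 0 \<and> dist s 0 < \<epsilon>"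
        by (auto simp: dist_norm)
    qed
  qed (use e(1) that in auto)
  have X_cont: "isCont X s" if "norm s < e" for s
    unfolding X_def
  proof (rule isCont_o2[where g = \<psi> and f = "\<lambda>s. s *s cvec k"])
    show "isCont (\<lambda>s. s *s cvec k) s"
      by (rule bounded_linear.continuous[OF vsm.bounded_linear_left continuous_ident])
    show "isCont \<psi> (s *s cvec k)" by (rule has_derivative_continuous[OF der(1)[OF inV[OF that]]])
  qed
  obtain d1 where d1: "d1 > 0" "\<And>s. norm s < d1 \<Longrightarrow> norm (X s - cvec p) < d"
    using X_cont[of 0] e(1) d(1) X0 by (auto simp: continuous_at_eps_delta dist_norm)
  define \<alpha> where "\<alpha> s = vRe (X (of_real s))" for s :: real
  define v where "v s = vRe (D (of_real s))" for s :: real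
  have norm_vcnj: "norm (vcnj z) = norm z" for z :: "complex ^ 'n"
    by (simp add: norm_vec_def vcnj_def)
  \<comment> \<open>For real \<open>s\<close> the value of \<open>F\<close> at this point is real,
    so the point and its conjugate have the same image. The bound by \<open>d1\<close> keeps both in
    a ball with real centre inside \<open>U\<close>, where \<open>F\<close> is injective.\<close>
  have real_X: "cvec (\<alpha> s) = X (of_real s)" if "\<bar>s\<bar> < min d1 e" for s
  proof -
    define z where "z = X (of_real s)"
    have "norm (z - cvec p) < d" using d1(2)[of "of_real s"] that by (simp add: z_def)
    moreover have "vcnj z - cvec p = vcnj (z - cvec p)" by (simp add: vcnj_simps cvec_simps)
    ultimately have zU: "z \<in> U" "vcnj z \<in> U"
      using d(2) by (auto simp: subset_iff dist_norm norm_minus_commute norm_vcnj)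
    have "F z = of_real s *s cvec k" using inv2[OF inV] that by (simp add: z_def X_def)
    then have "F (vcnj z) = F z" by (simp add: F_vcnj vcnj_simps cvec_simps)
    then have "vcnj z = z" using inv1 zU by metis
    then show ?thesis unfolding \<alpha>_def z_def[symmetric] by (rule cvec_vRe)
  qed
  have crit: "pgrad w r (\<alpha> s) = 0" if "\<bar>s\<bar> < min d1 e" for s
  proof -
    have "cvec (pgrad w r (\<alpha> s)) = pgrad W r (X (of_real s))"
      unfolding real_X[OF that, symmetric] W pgrad_cvec ..
    also have "\<dots> = 0" using FX[of "of_real s"] h0[of "of_real s"] that by simp
    finally show ?thesis by (simp add: cvec_simps(4)[symmetric] cvec_simps(5) del: cvec_simps(4))
  qed
  have k\<alpha>: "k \<bullet> (\<alpha> s - p) = s" if "\<bar>s\<bar> < min d1 e" for s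
  proof -
    have "of_real s = bdot (cvec k) (cvec (\<alpha> s) - cvec p)"
      using h0[of "of_real s"] that unfolding real_X[OF that] h_def by simp
    also have "\<dots> = of_real (k \<bullet> (\<alpha> s - p))"
      by (simp add: cvec_simps(2)[symmetric] bdot_cvec bdot_real)
    finally show ?thesis by simp
  qed
  have \<alpha>_der: "(\<alpha> has_vector_derivative v s) (at s)" if "\<bar>s\<bar> < e" for s
    unfolding has_vector_derivative_def has_derivative_componentwise_within[of \<alpha>]
  proof
    fix b :: "real ^ 'n" assume "b \<in> Basis"
    then obtain i where b: "b = axis i 1" by (auto simp: Basis_vec_def)
    have "((\<lambda>s. X (of_real s) $ i) has_vector_derivative D (of_real s) $ i) (at s)"
      using has_vector_derivative_real_field[of "\<lambda>s. X s $ i"] X_der[of "of_real s"] that by simp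
    then have "((\<lambda>s. Re (X (of_real s) $ i)) has_vector_derivative Re (D (of_real s) $ i)) (at s)"
      by (rule bounded_linear.has_vector_derivative[OF bounded_linear_Re])
    then show "((\<lambda>x. \<alpha> x \<bullet> b) has_derivative (\<lambda>x. (x *\<^sub>R v s) \<bullet> b)) (at s)"
      by (simp add: b inner_axis \<alpha>_def v_def vRe_def has_vector_derivative_def)
  qed
  have \<alpha>0: "\<alpha> 0 = p" by (simp add: \<alpha>_def X0 cvec_simps)
  \<comment> \<open>Differentiating the two identities along the arc at 0 puts \<open>v 0\<close> in
    the kernel with \<open>k\<close>-component 1. Thus the arc starts with unit speed, and by
    continuity its speed stays below 11/10 nearby.\<close>
  have v0: "v 0 = k"
  proof -
    define m where "m = min d1 e"
    have m: "m > 0" using d1(1) e(1) by (simp add: m_def)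
    have mem: "\<forall>\<^sub>F s in nhds 0. s \<in> ball (0::real) m"
      using m by (intro eventually_nhds_in_open) auto
    have der0: "(\<alpha> has_derivative (\<lambda>t. t *\<^sub>R v 0)) (at 0)"
      using \<alpha>_der[of 0] e(1) by (simp add: has_vector_derivative_def)
    have "((\<lambda>s. pgrad w r (\<alpha> s)) has_derivative (\<lambda>t. phess w r p (t *\<^sub>R v 0))) (at 0)"
      by (rule has_derivative_compose[OF der0, of "pgrad w r"]) (simp add: \<alpha>0 pgrad_has_derivative)
    moreover have "((\<lambda>s. pgrad w r (\<alpha> s)) has_derivative (\<lambda>t. 0)) (at 0)"
    proof (rule has_derivative_transform_eventually[OF has_derivative_const[of 0]])
      show "\<forall>\<^sub>F x in at 0. 0 = pgrad w r (\<alpha> x)"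
        using crit by (intro eventually_mono[OF filter_leD[OF at_within_le_nhds mem]]) (auto simp: m_def)
    qed (use crit[of 0] m in \<open>auto simp: m_def\<close>)
    ultimately have "(\<lambda>t. phess w r p (t *\<^sub>R v 0)) = (\<lambda>t. 0)" by (rule has_derivative_unique)
    from fun_cong[OF this, of 1] have Hv: "phess w r p (v 0) = 0" by simp
    have "((\<lambda>s. k \<bullet> (\<alpha> s - p)) has_derivative (\<lambda>t. k \<bullet> (t *\<^sub>R v 0))) (at 0)"
      by (rule has_derivative_eq_rhs[OF has_derivative_inner_right[OF has_derivative_diff[OF der0 has_derivative_const]]]) simp
    moreover have "((\<lambda>s. k \<bullet> (\<alpha> s - p)) has_derivative (\<lambda>t. t)) (at 0)"
    proof (rule has_derivative_transform_eventually[OF has_derivative_ident])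
      show "\<forall>\<^sub>F x in at 0. x = k \<bullet> (\<alpha> x - p)"
        using k\<alpha> by (intro eventually_mono[OF filter_leD[OF at_within_le_nhds mem]]) (auto simp: m_def)
    qed (use k\<alpha>[of 0] m in \<open>auto simp: m_def\<close>)
    ultimately have "(\<lambda>t. k \<bullet> (t *\<^sub>R v 0)) = (\<lambda>t. t)" by (rule has_derivative_unique)
    from fun_cong[OF this, of 1] have kv: "k \<bullet> v 0 = 1" by simp
    interpret bounded_linear "phess w r p" by (rule bounded_linear_phess)
    from kv have "v 0 - k = 0"
      by - (rule kernel_line[OF stc k], simp_all add: diff Hv k(2) inner_diff_right kk)
    then show ?thesis by simp
  qed
  have "isCont v 0"
  proof -
    have "isCont (\<lambda>s. v s $ i) 0" for i
    proof -
      have "continuous_on (ball 0 e) (deriv (\<lambda>s. X s $ i))"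
        by (intro holomorphic_on_imp_continuous_on holomorphic_deriv X_hol open_ball)
      then have "isCont (deriv (\<lambda>s. X s $ i)) 0"
        using e(1) by (simp add: continuous_on_eq_continuous_at)
      then have "isCont (\<lambda>s. Re (deriv (\<lambda>s. X s $ i) (of_real s))) 0"
        by (intro continuous_intros isCont_o2[where f = of_real]) simp_all
      moreover have "\<forall>\<^sub>F s in nhds (0::real). Re (deriv (\<lambda>s. X s $ i) (of_real s)) = v s $ i"
      proof (rule eventually_mono[OF eventually_nhds_in_open[of "ball 0 e" 0]])
        fix s :: real assume "s \<in> ball 0 e"
        then show "Re (deriv (\<lambda>s. X s $ i) (of_real s)) = v s $ i"
          using DERIV_imp_deriv[OF X_der[of "of_real s" i]] by (simp add: v_def vRe_def)
      qed (use e(1) in auto)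
      ultimately show ?thesis by (simp add: isCont_cong)
    qed
    then show ?thesis
      by (simp add: isCont_def vec_tendstoI)
  qed
  then obtain d2 where d2: "d2 > 0" "\<And>s. \<bar>s\<bar> < d2 \<Longrightarrow> norm (v s - k) < 1 / 10"
    unfolding continuous_at_eps_delta v0 dist_norm
    by (metis diff_zero real_norm_def zero_less_divide_1_iff zero_less_numeral)
  define \<delta> where "\<delta> = Min {d, d1, e, d2}"
  have \<delta>: "\<delta> > 0" "\<delta> \<le> d" "\<delta> \<le> d1" "\<delta> \<le> e" "\<delta> \<le> d2"
    using d(1) d1(1) e(1) d2(1) by (auto simp: \<delta>_def)
  show thesis
  proof (rule that[OF \<delta>(1) k(1)])
    fix s :: real assume s: "\<bar>s\<bar> < \<delta>"
    have sm: "\<bar>t\<bar> < min d1 e" if "\<bar>t\<bar> < \<delta>" for t using that \<delta> by simp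
    have "norm (v s) \<le> 11 / 10"
      using d2(2)[of s] s \<delta>(5) norm_triangle_sub[of "v s" k] k(1) by simp
    moreover have der_s: "(\<alpha> has_vector_derivative v s) (at s)" using \<alpha>_der s \<delta>(4) by simp
    moreover have "\<alpha> s islimpt Z"
      unfolding islimpt_approachable
    proof (intro allI impI)
      fix \<epsilon> :: real assume eps: "\<epsilon> > 0"
      have "isCont \<alpha> s" using der_s has_vector_derivative_continuous by blast
      then obtain \<eta> where \<eta>: "\<eta> > 0" "\<And>t. \<bar>t - s\<bar> < \<eta> \<Longrightarrow> dist (\<alpha> t) (\<alpha> s) < \<epsilon>"
        using eps unfolding continuous_at_eps_delta dist_real_def by blast
      define m where "m = min \<eta> (\<delta> - \<bar>s\<bar>)"
      have m: "0 < m" "m \<le> \<eta>" "m \<le> \<delta> - \<bar>s\<bar>" using \<eta>(1) s by (auto simp: m_def)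
      \<comment> \<open>Every nearby parameter gives another zero of the gradient, distinct from
        \<open>\<alpha> s\<close> by its \<open>k\<close>-coordinate. Half of the margin
        \<open>m\<close> stays inside the arc.\<close>
      define t where "t = s + m / 2"
      have t: "\<bar>t - s\<bar> < \<eta>" "\<bar>t\<bar> < \<delta>" "t \<noteq> s" using m unfolding t_def by linarith+
      have "\<alpha> t \<noteq> \<alpha> s" using k\<alpha>[OF sm[OF t(2)]] k\<alpha>[OF sm[OF s]] t(3) by auto
      then show "\<exists>y\<in>Z. y \<noteq> \<alpha> s \<and> dist y (\<alpha> s) < \<epsilon>"
        using crit[OF sm[OF t(2)]] \<eta>(2)[OF t(1)] by (auto simp: Z_def)
    qed
    ultimately show "\<alpha> s islimpt Z \<and> k \<bullet> (\<alpha> s - p) = s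
        \<and> (\<exists>v. (\<alpha> has_vector_derivative v) (at s) \<and> norm v \<le> 11 / 10)"
      using k\<alpha>[OF sm[OF s]] by blast
  next
    fix x assume x: "x \<in> Z" "norm (x - p) < \<delta>"
    have "cvec x = X (of_real (k \<bullet> (x - p)))"
      using x \<delta>(2) by (intro onX inU) (auto simp: Z_def)
    then show "x = \<alpha> (k \<bullet> (x - p))" unfolding \<alpha>_def by (metis cvec_simps(6))
  qed
qed

subsection \<open>Area contraction by gradient descent\<close>

lemma compact_pos_lower_bound:
  fixes f :: "'a::topological_space \<Rightarrow> real"
  assumes "compact S" "continuous_on S f" "\<And>x. x \<in> S \<Longrightarrow> 0 < f x"
  obtains c where "0 < c" "\<And>x. x \<in> S \<Longrightarrow> c \<le> f x"
proof (cases "S = {}")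
  case False
  then obtain y where "y \<in> S" "\<And>x. x \<in> S \<Longrightarrow> f y \<le> f x"
    using continuous_attains_inf[OF assms(1) False assms(2)] by blast
  then show ?thesis using that assms(3) by blast
qed (use that[of 1] in auto)

lemma compact_norm_upper_bound:
  fixes f :: "'a::topological_space \<Rightarrow> 'b::real_normed_vector"
  assumes "compact S" "continuous_on S f"
  obtains C where "0 < C" "\<And>x. x \<in> S \<Longrightarrow> norm (f x) \<le> C"
  using compact_imp_bounded[OF compact_continuous_image[OF assms(2,1)]]
  unfolding bounded_pos by blast

text \<open>An alternating form does not change when \<open>u\<close> is replaced by its component
  orthogonal to \<open>v\<close>, and this component is no longer than \<open>u\<close>. Orthonormal
  pairs therefore suffice.\<close>

lemma alternating_bound:
  fixes W :: "'a::real_inner \<Rightarrow> 'a \<Rightarrow> real"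
  assumes lin: "\<And>v. linear (\<lambda>u. W u v)" "\<And>u. linear (W u)" and alt: "\<And>u. W u u = 0"
    and M: "M \<ge> 0" "\<And>a b. norm a = 1 \<Longrightarrow> norm b = 1 \<Longrightarrow> a \<bullet> b = 0 \<Longrightarrow> \<bar>W a b\<bar> \<le> M"
  shows "\<bar>W u v\<bar> \<le> M * norm u * norm v"
proof (cases "v = 0")
  case True
  then show ?thesis using linear_0[OF lin(2)] by simp
next
  case False
  define e where "e = (1 / norm v) *\<^sub>R v"
  define u' where "u' = u - (u \<bullet> e) *\<^sub>R e"
  have e: "norm e = 1" "v = norm v *\<^sub>R e" using False by (simp_all add: e_def)
  have ee: "e \<bullet> e = 1" using e(1) by (simp add: dot_square_norm)
  have orth: "u' \<bullet> e = 0" by (simp add: u'_def inner_diff_left ee)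
  have "W u v = norm v * W u e" by (subst e(2)) (simp add: linear_scale[OF lin(2)])
  also have "W u e = W u' e"
    unfolding u'_def using linear_diff[OF lin(1)[of e]] linear_scale[OF lin(1)[of e]] alt by simp
  finally have Wuv: "\<bar>W u v\<bar> = norm v * \<bar>W u' e\<bar>" by (simp add: abs_mult)
  have "\<bar>W u' e\<bar> \<le> M * norm u'"
  proof (cases "u' = 0")
    case True
    then show ?thesis using linear_0[OF lin(1)] by simp
  next
    case False
    define f where "f = (1 / norm u') *\<^sub>R u'"
    have f: "norm f = 1" "f \<bullet> e = 0" "u' = norm u' *\<^sub>R f" using False orth by (simp_all add: f_def)
    have "W u' e = norm u' * W f e" by (subst f(3)) (simp add: linear_scale[OF lin(1)])
    then show ?thesis using M(2)[OF f(1) e(1) f(2)] by (simp add: abs_mult mult.commute[of M] mult_left_mono)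
  qed
  also have "norm u' \<le> norm u"
  proof (rule power2_le_imp_le)
    have "u = u' + (u \<bullet> e) *\<^sub>R e" by (simp add: u'_def)
    then have "u \<bullet> u = u' \<bullet> u' + (u \<bullet> e)\<^sup>2"
      using orth ee by (smt (verit) inner_add_left inner_add_right inner_commute inner_scaleR_left
          inner_scaleR_right mult.right_neutral mult_zero_right power2_eq_square)
    then show "(norm u')\<^sup>2 \<le> (norm u)\<^sup>2" by (simp add: power2_norm_eq_inner)
  qed simp
  finally have "\<bar>W u' e\<bar> \<le> M * norm u" using M(1) by (simp add: mult_left_mono)
  then show ?thesis unfolding Wuv by (simp add: mult.commute mult_left_mono)
qed

text \<open>By the inequality of arithmetic and geometric means the product of the two norms is at
  most the mean of their squares, which is 1 - \<epsilon> times the trace plus an error of order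
  \<epsilon>^2. Compactness makes the trace uniformly positive.\<close>

lemma descent_step_constants:
  fixes w :: "nat \<Rightarrow> real ^ 'n"
  assumes stc: "strictly_two_convex w r" and r: "r \<ge> 1"
  obtains R \<epsilon> \<theta> where "0 < R" "0 \<le> \<theta>" "\<theta> < 1"
    "\<And>x. pgrad w r x = 0 \<Longrightarrow> norm x \<le> R"
    "\<And>x. norm x \<le> R \<Longrightarrow> norm (x - \<epsilon> *\<^sub>R pgrad w r x) \<le> R"
    "\<And>x a b. norm x \<le> R \<Longrightarrow> norm a = 1 \<Longrightarrow> norm b = 1 \<Longrightarrow> a \<bullet> b = 0 \<Longrightarrow>
       norm (a - \<epsilon> *\<^sub>R phess w r x a) * norm (b - \<epsilon> *\<^sub>R phess w r x b) \<le> \<theta>"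
proof -
  define R0 where "R0 = 1 + (\<Sum>i<r. norm (w i))"
  have wR0: "norm (w i) < R0" if "i < r" for i
    using member_le_sum[of i "{..<r}" "\<lambda>i. norm (w i)"] that by (simp add: R0_def)
  have R0: "R0 > 0" by (simp add: R0_def add_pos_nonneg sum_nonneg)
  define R where "R = R0 + 1"
  have out: "0 < x \<bullet> pgrad w r x" if "norm x \<ge> R0" for x
  proof -
    have x: "x \<notin> w ` {..<r}" using lgrad_outward(1)[OF r _ that] wR0 by blast
    have "0 < x \<bullet> lgrad w r x" using lgrad_outward(2)[OF r _ that] wR0 by blast
    then show ?thesis using pot_pos[OF x] by (simp add: pgrad_eq_lgrad[OF x])
  qed
  obtain C1 where C1: "C1 > 0" "\<And>x. x \<in> cball 0 R \<Longrightarrow> norm (pgrad w r x) \<le> C1"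
    by (rule compact_norm_upper_bound[OF compact_cball, of 0 R "pgrad w r"]) (auto intro!: continuous_intros)
  obtain C2 where C2: "C2 > 0"
      "\<And>z. z \<in> cball 0 R \<times> cball 0 1 \<Longrightarrow> norm (phess w r (fst z) (snd z)) \<le> C2"
    by (rule compact_norm_upper_bound[of "cball 0 R \<times> cball 0 1" "\<lambda>z. phess w r (fst z) (snd z)"])
      (auto intro!: continuous_intros compact_Times)
  define C where "C = max C1 C2"
  have C: "C > 0" "\<And>x. norm x \<le> R \<Longrightarrow> norm (pgrad w r x) \<le> C"
    "\<And>x h. norm x \<le> R \<Longrightarrow> norm h \<le> 1 \<Longrightarrow> norm (phess w r x h) \<le> C"
    using C1 C2(1) C2(2)[of "(x, h)" for x h] by (fastforce simp: C_def)+
  have cAn: "compact (cball 0 R \<inter> {x :: real ^ 'n. R0 \<le> norm x})"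
    by (intro compact_Int_closed compact_cball closed_Collect_le continuous_intros)
  obtain c where c: "c > 0" "\<And>x. x \<in> cball 0 R \<inter> {x. R0 \<le> norm x} \<Longrightarrow> c \<le> x \<bullet> pgrad w r x"
    by (rule compact_pos_lower_bound[OF cAn, of "\<lambda>x. x \<bullet> pgrad w r x"])
      (use out in \<open>auto intro!: continuous_intros\<close>)
  \<comment> \<open>Orthonormal pairs over arbitrary base points, written as a closed set so that
    the trace attains a positive minimum over the compact ball.\<close>
  define S where "S = {z :: (real ^ 'n) \<times> (real ^ 'n) \<times> (real ^ 'n). norm (fst (snd z)) = 1} \<inter>
    {z. norm (snd (snd z)) = 1} \<inter> {z. fst (snd z) \<bullet> snd (snd z) = 0}"
  have "closed S" unfolding S_def
    by (intro closed_Int closed_Collect_eq continuous_intros)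
  then have "compact (cball 0 R \<times> cball 0 1 \<times> cball 0 1 \<inter> S)"
    by (intro compact_Int_closed compact_Times compact_cball)
  moreover have "continuous_on T (\<lambda>z :: (real ^ 'n) \<times> (real ^ 'n) \<times> (real ^ 'n).
      fst (snd z) \<bullet> phess w r (fst z) (fst (snd z)) + snd (snd z) \<bullet> phess w r (fst z) (snd (snd z)))" for T
    by (intro continuous_intros)
  ultimately obtain \<kappa>0 where \<kappa>0: "\<kappa>0 > 0" "\<And>z. z \<in> cball 0 R \<times> cball 0 1 \<times> cball 0 1 \<inter> S \<Longrightarrow>
      \<kappa>0 \<le> fst (snd z) \<bullet> phess w r (fst z) (fst (snd z)) + snd (snd z) \<bullet> phess w r (fst z) (snd (snd z))"
    by (rule compact_pos_lower_bound) (use stc in \<open>auto simp: S_def strictly_two_convex_def\<close>)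
  \<comment> \<open>The four bounds serve in turn: a step has length at most 1 and so leads from
    radius \<open>R0\<close> to at most \<open>R\<close>; in the outer shell the inward gain
    outweighs the quadratic term; the quadratic error costs at most half of the trace gain; \<theta>
    stays nonnegative.\<close>
  define \<epsilon> where "\<epsilon> = Min {1 / C, c / C\<^sup>2, \<kappa>0 / (2 * C\<^sup>2), 1 / \<kappa>0}"
  have \<epsilon>: "\<epsilon> > 0" "\<epsilon> \<le> 1 / C" "\<epsilon> \<le> c / C\<^sup>2" "\<epsilon> \<le> \<kappa>0 / (2 * C\<^sup>2)" "\<epsilon> \<le> 1 / \<kappa>0"
    using C(1) c(1) \<kappa>0(1) unfolding \<epsilon>_def by (simp_all add: Min_le_iff del: Min_le) 
  have \<epsilon>': "\<epsilon> * C \<le> 1" "\<epsilon> * C\<^sup>2 \<le> c" "\<epsilon> * C\<^sup>2 \<le> \<kappa>0 / 2" "\<epsilon> * \<kappa>0 \<le> 1"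
    using \<epsilon> C(1) \<kappa>0(1) by (simp_all add: field_simps)
  define \<theta> where "\<theta> = 1 - \<epsilon> * \<kappa>0 / 2"
  show thesis
  proof (rule that[of R \<theta> \<epsilon>])
    show "0 < R" using R0 by (simp add: R_def)
    show "0 \<le> \<theta>" "\<theta> < 1" using \<epsilon>'(4) \<epsilon>(1) \<kappa>0(1) by (auto simp: \<theta>_def)
    show "norm x \<le> R" if "pgrad w r x = 0" for x
      using out[of x] that by (force simp: R_def)
    show "norm (x - \<epsilon> *\<^sub>R pgrad w r x) \<le> R" if x: "norm x \<le> R" for x
    proof (cases "norm x \<le> R0")
      case True
      have "norm (x - \<epsilon> *\<^sub>R pgrad w r x) \<le> norm x + \<epsilon> * norm (pgrad w r x)"
        using norm_triangle_ineq4[of x "\<epsilon> *\<^sub>R pgrad w r x"] \<epsilon>(1) by simp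
      also have "\<dots> \<le> R0 + \<epsilon> * C"
        using True C(2)[OF x] \<epsilon>(1) by (intro add_mono mult_left_mono) auto
      finally show ?thesis using \<epsilon>'(1) by (simp add: R_def)
    next
      case False
      have "(norm (x - \<epsilon> *\<^sub>R pgrad w r x))\<^sup>2
          = (norm x)\<^sup>2 - 2 * \<epsilon> * (x \<bullet> pgrad w r x) + \<epsilon> * (\<epsilon> * (norm (pgrad w r x))\<^sup>2)"
        unfolding power2_norm_eq_inner
        by (simp add: inner_diff_left inner_diff_right inner_commute algebra_simps)
      also have "\<dots> \<le> R\<^sup>2 - 2 * \<epsilon> * c + \<epsilon> * (\<epsilon> * C\<^sup>2)"
        using x c(2)[of x] False \<epsilon>(1) C(2)[OF x]
        by (intro add_mono diff_mono mult_left_mono power_mono) auto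
      also have "\<dots> \<le> R\<^sup>2 - 2 * \<epsilon> * c + \<epsilon> * c"
        using \<epsilon>'(2) \<epsilon>(1) by (intro add_mono mult_left_mono) auto
      also have "\<dots> \<le> R\<^sup>2" using \<epsilon>(1) c(1) by simp
      finally show ?thesis by (rule power2_le_imp_le) (use R0 in \<open>simp add: R_def\<close>)
    qed
    show "norm (a - \<epsilon> *\<^sub>R phess w r x a) * norm (b - \<epsilon> *\<^sub>R phess w r x b) \<le> \<theta>"
      if x: "norm x \<le> R" and ab: "norm a = 1" "norm b = 1" "a \<bullet> b = 0" for x a b
    proof -
      have sq: "(norm (u - \<epsilon> *\<^sub>R phess w r x u))\<^sup>2 \<le> 1 - 2 * \<epsilon> * (u \<bullet> phess w r x u) + \<epsilon> * (\<epsilon> * C\<^sup>2)"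
        if "norm u = 1" for u
      proof -
        have "(norm (u - \<epsilon> *\<^sub>R phess w r x u))\<^sup>2
            = (norm u)\<^sup>2 - 2 * \<epsilon> * (u \<bullet> phess w r x u) + \<epsilon> * (\<epsilon> * (norm (phess w r x u))\<^sup>2)"
          unfolding power2_norm_eq_inner
          by (simp add: inner_diff_left inner_diff_right inner_commute algebra_simps)
        also have "\<dots> \<le> 1 - 2 * \<epsilon> * (u \<bullet> phess w r x u) + \<epsilon> * (\<epsilon> * C\<^sup>2)"
          using that \<epsilon>(1) C(3)[OF x, of u] by (intro add_mono mult_left_mono power_mono) auto
        finally show ?thesis .
      qed
      have tr: "\<kappa>0 \<le> a \<bullet> phess w r x a + b \<bullet> phess w r x b"
        using \<kappa>0(2)[of "(x, a, b)"] x ab by (simp add: S_def)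
      have am: "2 * (p * q) \<le> p\<^sup>2 + q\<^sup>2" for p q :: real
        using sum_squares_bound[of p q] by simp
      have "2 * (norm (a - \<epsilon> *\<^sub>R phess w r x a) * norm (b - \<epsilon> *\<^sub>R phess w r x b))
          \<le> 2 - 2 * (\<epsilon> * (a \<bullet> phess w r x a + b \<bullet> phess w r x b)) + 2 * (\<epsilon> * (\<epsilon> * C\<^sup>2))"
        using am[of "norm (a - \<epsilon> *\<^sub>R phess w r x a)" "norm (b - \<epsilon> *\<^sub>R phess w r x b)"]
          sq[OF ab(1)] sq[OF ab(2)] by (simp add: algebra_simps)
      also have "\<dots> \<le> 2 - 2 * (\<epsilon> * \<kappa>0) + 2 * (\<epsilon> * (\<kappa>0 / 2))"
        using tr \<epsilon>'(3) \<epsilon>(1) by (intro add_mono diff_mono mult_left_mono) auto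
      finally show ?thesis by (simp add: \<theta>_def)
    qed
  qed
qed

text \<open>
  The third condition bounds the exterior derivative of the 1-form \<open>A \<bullet> dx\<close>.
\<close>

definition curl_bounded :: "real \<Rightarrow> real \<Rightarrow> (real ^ 'n \<Rightarrow> real ^ 'n) \<Rightarrow> bool" where
  "curl_bounded R M A \<longleftrightarrow> (\<exists>A'. (\<forall>x. (A has_derivative A' x) (at x))
     \<and> continuous_on UNIV (\<lambda>z. A' (fst z) (snd z))
     \<and> (\<forall>x h y. norm x \<le> R \<longrightarrow> \<bar>A' x h \<bullet> y - A' x y \<bullet> h\<bar> \<le> M * norm h * norm y))"

text \<open>By symmetry of the Hessian, the field in the conclusion represents the pullback of the
  form \<open>A \<bullet> dx\<close> under \<open>G\<close>. Pullback commutes with the exterior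
  derivative, so the bound is multiplied by the area factor of \<open>G\<close>.\<close>

lemma curl_bounded_pullback:
  fixes w :: "nat \<Rightarrow> real ^ 'n"
  assumes A: "curl_bounded R M A" and M: "M \<ge> 0"
    and G: "\<And>x. norm x \<le> R \<Longrightarrow> norm (x - \<epsilon> *\<^sub>R pgrad w r x) \<le> R"
    and contr: "\<And>x a b. norm x \<le> R \<Longrightarrow> norm a = 1 \<Longrightarrow> norm b = 1 \<Longrightarrow> a \<bullet> b = 0 \<Longrightarrow>
       norm (a - \<epsilon> *\<^sub>R phess w r x a) * norm (b - \<epsilon> *\<^sub>R phess w r x b) \<le> \<theta>"
    and \<theta>: "0 \<le> \<theta>"
  defines "G \<equiv> \<lambda>x. x - \<epsilon> *\<^sub>R pgrad w r x"
  shows "curl_bounded R (M * \<theta>) (\<lambda>x. A (G x) - \<epsilon> *\<^sub>R phess w r x (A (G x)))"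
proof -
  obtain A' where A': "\<And>x. (A has_derivative A' x) (at x)"
    "continuous_on UNIV (\<lambda>z. A' (fst z) (snd z))"
    "\<And>x h y. norm x \<le> R \<Longrightarrow> \<bar>A' x h \<bullet> y - A' x y \<bullet> h\<bar> \<le> M * norm h * norm y"
    using A unfolding curl_bounded_def by blast
  define L where "L x h = h - \<epsilon> *\<^sub>R phess w r x h" for x h
  define B' where "B' x h = A' (G x) (L x h)
    - \<epsilon> *\<^sub>R (pthird w r x h (A (G x)) + phess w r x (A' (G x) (L x h)))" for x h
  have G_der: "(G has_derivative L x) (at x)" for x
    unfolding G_def L_def
    by (intro has_derivative_diff has_derivative_ident has_derivative_scaleR_right pgrad_has_derivative)
  have AG: "((\<lambda>x. A (G x)) has_derivative (\<lambda>h. A' (G x) (L x h))) (at x)" for x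
    by (rule has_derivative_compose[OF G_der A'(1)])
  have B_der: "((\<lambda>x. A (G x) - \<epsilon> *\<^sub>R phess w r x (A (G x))) has_derivative B' x) (at x)" for x
    unfolding B'_def
    by (intro has_derivative_diff has_derivative_scaleR_right phess_has_derivative AG)
  have cA: "continuous_on S A" for S
    by (meson A'(1) continuous_at_imp_continuous_on has_derivative_continuous)
  have cG: "continuous_on S (\<lambda>z. G (f z))" if "continuous_on S f" for S and f :: "'z::topological_space \<Rightarrow> _"
    unfolding G_def by (intro continuous_intros that)
  have cAG: "continuous_on S (\<lambda>z. A (G (f z)))" if "continuous_on S f" for S and f :: "'z::topological_space \<Rightarrow> _"
    by (rule continuous_on_compose2[OF cA[of UNIV] cG[OF that]]) simp
  have cA': "continuous_on S (\<lambda>z. A' (f z) (u z))" if "continuous_on S f" "continuous_on S u"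
    for S and f u :: "'z::topological_space \<Rightarrow> _"
    using continuous_on_compose2[OF A'(2) continuous_on_Pair[OF that]] by simp
  have "continuous_on UNIV (\<lambda>z. B' (fst z) (snd z))"
    unfolding B'_def L_def by (intro continuous_intros cA' cG cAG)
  moreover have "\<bar>B' x h \<bullet> y - B' x y \<bullet> h\<bar> \<le> M * \<theta> * norm h * norm y" if x: "norm x \<le> R" for x h y
  proof -
    \<comment> \<open>The exterior derivative of \<open>A\<close> evaluated on the images of
      \<open>h\<close> and \<open>y\<close>. The terms with \<open>pthird\<close> cancel in the
      antisymmetrisation.\<close>
    define W where "W h y = A' (G x) (L x h) \<bullet> L x y - A' (G x) (L x y) \<bullet> L x h" for h y
    have "B' x h \<bullet> y - B' x y \<bullet> h = W h y" for h y
    proof -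
      have s: "phess w r x u \<bullet> v = u \<bullet> phess w r x v" for u v
        using phess_sym[of w r x u v] by (simp add: bdot_real)
      have t: "pthird w r x h a \<bullet> y = pthird w r x y a \<bullet> h" for a
        using pthird_sym[of w r x h a y] by (simp add: bdot_real)
      have LL: "L x v = v - \<epsilon> *\<^sub>R phess w r x v" for v by (simp add: L_def)
      define p where "p = A' (G x) (L x h)"
      define q where "q = A' (G x) (L x y)"
      show ?thesis
        unfolding B'_def W_def p_def[symmetric] q_def[symmetric] unfolding LL
        by (simp add: inner_diff_left inner_add_left inner_diff_right s t)
          (simp add: algebra_simps)
    qed
    moreover have "\<bar>W h y\<bar> \<le> M * \<theta> * norm h * norm y"
    proof (rule alternating_bound)
      have lL: "linear (L x)" using G_der has_derivative_linear by blast
      have lA: "linear (A' (G x))" using A'(1) has_derivative_linear by blast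
      show "linear (\<lambda>u. W u v)" "linear (W v)" for v
        unfolding W_def by (auto intro!: linearI simp: linear_add[OF lL] linear_scale[OF lL]
            linear_add[OF lA] linear_scale[OF lA] inner_add_left inner_add_right algebra_simps)
      show "W u u = 0" for u by (simp add: W_def)
      show "0 \<le> M * \<theta>" using M \<theta> by simp
      show "\<bar>W a b\<bar> \<le> M * \<theta>" if ab: "norm a = 1" "norm b = 1" "a \<bullet> b = 0" for a b
      proof -
        have "\<bar>W a b\<bar> \<le> M * (norm (L x a) * norm (L x b))"
          using A'(3)[OF G[OF x], of "L x a" "L x b"] unfolding W_def G_def by (simp add: mult.assoc)
        also have "\<dots> \<le> M * \<theta>"
          using contr[OF x ab] M unfolding L_def by (rule mult_left_mono)
        finally show ?thesis .
      qed
    qed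
    ultimately show ?thesis by simp
  qed
  ultimately show ?thesis unfolding curl_bounded_def using B_der by blast
qed

text \<open>This is the homotopy operator of the Poincare lemma. Its error is the integral over
  [0,1] of t dA(h, x) at \<open>t *\<^sub>R x\<close>, so it vanishes for closed forms and is
  controlled by the curl bound in general.\<close>

lemma radial_primitive:
  fixes A :: "real ^ 'n \<Rightarrow> real ^ 'n"
  assumes A: "curl_bounded R M A" and M: "M \<ge> 0" and x: "norm x \<le> R"
  obtains \<Phi>' where "((\<lambda>x. integral {0..1} (\<lambda>t. A (t *\<^sub>R x) \<bullet> x)) has_derivative \<Phi>') (at x)"
    "\<And>h. \<bar>\<Phi>' h - A x \<bullet> h\<bar> \<le> M * norm h * norm x"
proof -
  obtain A' where A': "\<And>x. (A has_derivative A' x) (at x)"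
    "continuous_on UNIV (\<lambda>z. A' (fst z) (snd z))"
    "\<And>x h y. norm x \<le> R \<Longrightarrow> \<bar>A' x h \<bullet> y - A' x y \<bullet> h\<bar> \<le> M * norm h * norm y"
    using A unfolding curl_bounded_def by blast
  have lA: "bounded_linear (A' x)" for x using A'(1) has_derivative_bounded_linear by blast
  have cA: "continuous_on S A" for S
    by (meson A'(1) continuous_at_imp_continuous_on has_derivative_continuous)
  have cA0: "continuous_on S (\<lambda>z. A (f z))" if "continuous_on S f" for S and f :: "'z::topological_space \<Rightarrow> _"
    by (rule continuous_on_compose2[OF cA[of UNIV] that]) simp
  have cA': "continuous_on S (\<lambda>z. A' (f z) (u z))" if "continuous_on S f" "continuous_on S u"
    for S and f u :: "'z::topological_space \<Rightarrow> _"
    using continuous_on_compose2[OF A'(2) continuous_on_Pair[OF that]] by simp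
  define D where "D y t h = A (t *\<^sub>R y) \<bullet> h + A' (t *\<^sub>R y) (t *\<^sub>R h) \<bullet> y" for y :: "real ^ 'n" and t h
  have D_der: "((\<lambda>y. A (t *\<^sub>R y) \<bullet> y) has_derivative D y t) (at y)" for y t
  proof -
    have "((\<lambda>y. A (t *\<^sub>R y)) has_derivative (\<lambda>h. A' (t *\<^sub>R y) (t *\<^sub>R h))) (at y)"
      by (rule has_derivative_compose[OF _ A'(1)]) (auto intro!: derivative_eq_intros)
    from has_derivative_inner[OF this has_derivative_ident] show ?thesis unfolding D_def .
  qed
  have D_lin: "bounded_linear (D y t)" for y t using has_derivative_bounded_linear[OF D_der] .
  have cD: "continuous_on UNIV (\<lambda>(y, t). Blinfun (D y t))"
    by (rule continuous_on_blinfun_componentwise)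
      (auto simp: split_beta bounded_linear_Blinfun_apply[OF D_lin] D_def intro!: continuous_intros cA0 cA')
  have "((\<lambda>x. integral (cbox 0 1) (\<lambda>t. A (t *\<^sub>R x) \<bullet> x)) has_derivative
      blinfun_apply (integral (cbox 0 1) (\<lambda>t. Blinfun (D x t)))) (at x within UNIV)"
    by (rule leibniz_rule)
      (auto simp: bounded_linear_Blinfun_apply[OF D_lin] intro!: D_der integrable_continuous_real
        continuous_intros cA0 intro: continuous_on_subset[OF cD])
  then have der: "((\<lambda>x. integral {0..1} (\<lambda>t. A (t *\<^sub>R x) \<bullet> x)) has_derivative
      blinfun_apply (integral {0..1} (\<lambda>t. Blinfun (D x t)))) (at x)" by simp
  show thesis
  proof (rule that[OF der])
    fix h
    have int: "(\<lambda>t. Blinfun (D x t)) integrable_on {0..1}"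
      by (intro integrable_continuous_real
          continuous_on_compose2[OF cD, of _ "\<lambda>t. (x, t)", simplified]) (auto intro!: continuous_intros)
    have 1: "blinfun_apply (integral {0..1} (\<lambda>t. Blinfun (D x t))) h = integral {0..1} (\<lambda>t. D x t h)"
      by (simp add: blinfun_apply_integral[OF int] bounded_linear_Blinfun_apply[OF D_lin])
    \<comment> \<open>The derivative of t (A (t x) \<bullet> h), whose integral is exactly A x
      \<bullet> h. The difference from \<open>D x t h\<close> is t times the exterior
      derivative.\<close>
    define E where "E t = A (t *\<^sub>R x) \<bullet> h + t * (A' (t *\<^sub>R x) x \<bullet> h)" for t
    have "(E has_integral 1 * (A (1 *\<^sub>R x) \<bullet> h) - 0 * (A (0 *\<^sub>R x) \<bullet> h)) {0..1}"
    proof (rule fundamental_theorem_of_calculus)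
      fix t :: real
      have "((\<lambda>t. A (t *\<^sub>R x)) has_derivative (\<lambda>s. A' (t *\<^sub>R x) (s *\<^sub>R x))) (at t within {0..1})"
        by (rule has_derivative_compose[OF _ A'(1)]) (auto intro!: derivative_eq_intros)
      then have "((\<lambda>t. A (t *\<^sub>R x)) has_vector_derivative A' (t *\<^sub>R x) x) (at t within {0..1})"
        unfolding has_vector_derivative_def by (simp add: bounded_linear.linear[OF lA, THEN linear_scale])
      then have "((\<lambda>t. A (t *\<^sub>R x) \<bullet> h) has_vector_derivative A' (t *\<^sub>R x) x \<bullet> h) (at t within {0..1})"
        by (rule bounded_linear.has_vector_derivative[OF bounded_linear_inner_left])
      then show "((\<lambda>t. t * (A (t *\<^sub>R x) \<bullet> h)) has_vector_derivative E t) (at t within {0..1})"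
        unfolding E_def by (auto intro!: derivative_eq_intros simp: has_real_derivative_iff_has_vector_derivative[symmetric])
    qed simp
    then have 2: "(E has_integral (A x \<bullet> h)) {0..1}" by simp
    have "(\<lambda>t. D x t h) integrable_on {0..1}"
      unfolding D_def by (intro integrable_continuous_real continuous_intros cA0 cA')
    then have 3: "((\<lambda>t. D x t h) has_integral integral {0..1} (\<lambda>t. D x t h)) {0..1}"
      by (rule integrable_integral)
    have "norm (integral {0..1} (\<lambda>t. D x t h) - A x \<bullet> h) \<le> (M * norm h * norm x) * measure lborel (cbox 0 (1::real))"
    proof (rule has_integral_bound)
      show "0 \<le> M * norm h * norm x" using M by simp
      show "((\<lambda>t. D x t h - E t) has_integral (integral {0..1} (\<lambda>t. D x t h) - A x \<bullet> h)) (cbox 0 1)"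
        using has_integral_diff[OF 3 2] by simp
      fix t :: real assume "t \<in> cbox 0 1"
      then have t: "0 \<le> t" "t \<le> 1" by auto
      have "norm (t *\<^sub>R x) \<le> R" using t x mult_mono[of t 1 "norm x" "norm x"] by simp
      from A'(3)[OF this, of h x]
      have "t * \<bar>A' (t *\<^sub>R x) h \<bullet> x - A' (t *\<^sub>R x) x \<bullet> h\<bar> \<le> 1 * (M * norm h * norm x)"
        using t by (intro mult_mono) auto
      moreover have "D x t h - E t = t * (A' (t *\<^sub>R x) h \<bullet> x - A' (t *\<^sub>R x) x \<bullet> h)"
        unfolding D_def E_def by (simp add: bounded_linear.linear[OF lA, THEN linear_scale] algebra_simps)
      ultimately show "norm (D x t h - E t) \<le> M * norm h * norm x"
        using t by (simp add: abs_mult)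
    qed
    then show "\<bar>blinfun_apply (integral {0..1} (\<lambda>t. Blinfun (D x t))) h - A x \<bullet> h\<bar> \<le> M * norm h * norm x"
      unfolding 1 by simp
  qed
qed

text \<open>Each pullback multiplies the curl bound by \<theta>, hence the error of the radial
  primitive tends to 0. The comparison with \<open>A\<close> survives only on the kernel of the
  Hessian, which contains the tangent directions of arcs of critical points.\<close>

lemma approximate_primitive:
  fixes w :: "nat \<Rightarrow> real ^ 'n"
  assumes stc: "strictly_two_convex w r" and r: "r \<ge> 1"
    and A: "\<And>R. \<exists>M\<ge>0. curl_bounded R M A" and \<eta>: "\<eta> > 0"
  obtains \<Phi> :: "real ^ 'n \<Rightarrow> real" where "\<And>x. pgrad w r x = 0 \<Longrightarrow> \<exists>\<Phi>'. (\<Phi> has_derivative \<Phi>') (at x) \<and>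
     (\<forall>h. phess w r x h = 0 \<longrightarrow> \<bar>\<Phi>' h - A x \<bullet> h\<bar> \<le> \<eta> * norm h)"
proof -
  obtain R \<epsilon> \<theta> where c: "0 < R" "0 \<le> \<theta>" "\<theta> < 1"
    "\<And>x. pgrad w r x = 0 \<Longrightarrow> norm x \<le> R"
    "\<And>x. norm x \<le> R \<Longrightarrow> norm (x - \<epsilon> *\<^sub>R pgrad w r x) \<le> R"
    "\<And>x a b. norm x \<le> R \<Longrightarrow> norm a = 1 \<Longrightarrow> norm b = 1 \<Longrightarrow> a \<bullet> b = 0 \<Longrightarrow>
       norm (a - \<epsilon> *\<^sub>R phess w r x a) * norm (b - \<epsilon> *\<^sub>R phess w r x b) \<le> \<theta>"
    using descent_step_constants[OF stc r] by metis
  obtain M where M: "M \<ge> 0" "curl_bounded R M A" using A by blast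
  have ex: "\<exists>B. curl_bounded R (M * \<theta> ^ n) B \<and>
      (\<forall>x h. pgrad w r x = 0 \<longrightarrow> phess w r x h = 0 \<longrightarrow> B x \<bullet> h = A x \<bullet> h)" for n
  proof (induction n)
    case 0
    then show ?case using M(2) by auto
  next
    case (Suc n)
    then obtain B where B: "curl_bounded R (M * \<theta> ^ n) B"
      "\<And>x h. pgrad w r x = 0 \<Longrightarrow> phess w r x h = 0 \<Longrightarrow> B x \<bullet> h = A x \<bullet> h" by blast
    have "curl_bounded R (M * \<theta> ^ n * \<theta>) (\<lambda>x. B (x - \<epsilon> *\<^sub>R pgrad w r x)
        - \<epsilon> *\<^sub>R phess w r x (B (x - \<epsilon> *\<^sub>R pgrad w r x)))"
      using M(1) c(2) by (intro curl_bounded_pullback B(1) c(5,6)) auto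
    \<comment> \<open>A critical point is fixed by the step, and the Hessian term pairs to 0 with a
      kernel vector by symmetry.\<close>
    moreover have "(B (x - \<epsilon> *\<^sub>R pgrad w r x) - \<epsilon> *\<^sub>R phess w r x (B (x - \<epsilon> *\<^sub>R pgrad w r x))) \<bullet> h = A x \<bullet> h"
      if "pgrad w r x = 0" "phess w r x h = 0" for x h
      using B(2)[OF that] that phess_sym[of w r x "B x" h] by (simp add: bdot_real inner_diff_left)
    ultimately show ?case by (auto simp: mult_ac)
  qed
  obtain n where n: "\<theta> ^ n * (M * R) < \<eta>"
  proof -
    have "(\<lambda>n. \<theta> ^ n * (M * R)) \<longlonglongrightarrow> 0 * (M * R)"
      using c(2,3) by (intro tendsto_intros LIMSEQ_realpow_zero) auto
    then have "(\<lambda>n. \<theta> ^ n * (M * R)) \<longlonglongrightarrow> 0" by simp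
    from order_tendstoD(2)[OF this \<eta>] obtain n where "\<theta> ^ n * (M * R) < \<eta>"
      using eventually_happens sequentially_bot by blast
    then show ?thesis by (rule that)
  qed
  obtain B where B: "curl_bounded R (M * \<theta> ^ n) B"
      "\<And>x h. pgrad w r x = 0 \<Longrightarrow> phess w r x h = 0 \<Longrightarrow> B x \<bullet> h = A x \<bullet> h" using ex by blast
  show thesis
  proof (rule that)
    fix x assume x: "pgrad w r x = 0"
    have Mn: "0 \<le> M * \<theta> ^ n" using M(1) c(2) by simp
    obtain \<Phi>' where \<Phi>': "((\<lambda>x. integral {0..1} (\<lambda>t. B (t *\<^sub>R x) \<bullet> x)) has_derivative \<Phi>') (at x)"
      "\<And>h. \<bar>\<Phi>' h - B x \<bullet> h\<bar> \<le> M * \<theta> ^ n * norm h * norm x"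
      by (rule radial_primitive[OF B(1) Mn c(4)[OF x]]) blast
    have "\<bar>\<Phi>' h - A x \<bullet> h\<bar> \<le> \<eta> * norm h" if "phess w r x h = 0" for h
    proof -
      have "\<bar>\<Phi>' h - A x \<bullet> h\<bar> \<le> M * \<theta> ^ n * norm h * norm x"
        using \<Phi>'(2)[of h] B(2)[OF x that] by simp
      also have "\<dots> \<le> M * \<theta> ^ n * norm h * R"
        using Mn c(4)[OF x] by (intro mult_left_mono) auto
      also have "\<dots> = (\<theta> ^ n * (M * R)) * norm h" by simp
      also have "\<dots> \<le> \<eta> * norm h" using n by (intro mult_right_mono) auto
      finally show ?thesis .
    qed
    with \<Phi>'(1) show "\<exists>\<Phi>'. ((\<lambda>x. integral {0..1} (\<lambda>t. B (t *\<^sub>R x) \<bullet> x)) has_derivative \<Phi>') (at x) \<and>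
     (\<forall>h. phess w r x h = 0 \<longrightarrow> \<bar>\<Phi>' h - A x \<bullet> h\<bar> \<le> \<eta> * norm h)" by blast
  qed
qed

section \<open>Bump forms\<close>

lemma pos_part_square_has_derivative:
  "((\<lambda>u::real. (max 0 u)\<^sup>2) has_real_derivative 2 * max 0 u) (at u)"
proof -
  consider "u < 0" | "u = 0" | "u > 0" by linarith
  then show ?thesis
  proof cases
    case 1
    have "((\<lambda>u::real. 0) has_real_derivative 2 * max 0 u) (at u)" using 1 by simp
    then show ?thesis
      by (rule has_field_derivative_transform_within_open[of _ _ _ "{..<0}"]) (use 1 in auto)
  next
    case 2
    have "((\<lambda>h::real. (max 0 h)\<^sup>2 / h) \<longlongrightarrow> 0) (at 0)"
    proof (rule tendsto_0_le[where f = "\<lambda>h. h" and K = 1])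
      show "((\<lambda>h::real. h) \<longlongrightarrow> 0) (at 0)" by (rule tendsto_ident_at)
      show "\<forall>\<^sub>F h::real in at 0. norm ((max 0 h)\<^sup>2 / h) \<le> norm h * 1"
        by (rule always_eventually) (simp add: max_def power2_eq_square)
    qed
    then show ?thesis by (simp add: 2 DERIV_def)
  next
    case 3
    have "((\<lambda>u::real. u\<^sup>2) has_real_derivative 2 * max 0 u) (at u)"
      using 3 by (auto intro!: derivative_eq_intros)
    then show ?thesis
      by (rule has_field_derivative_transform_within_open[of _ _ _ "{0<..}"]) (use 3 in auto)
  qed
qed

text \<open>Squaring the positive part makes the bump continuously differentiable, which is all the
  smoothness that \<open>curl_bounded\<close> asks for. The constant direction \<open>k\<close> will
  be the direction of the chart at the bump.\<close>

lemma curl_bounded_bump: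
  fixes q k :: "real ^ 'n"
  shows "\<exists>M\<ge>0. curl_bounded R M (\<lambda>x. (max 0 (\<rho> - (x - q) \<bullet> (x - q)))\<^sup>2 *\<^sub>R k)"
proof -
  define c where "c x = 2 * max 0 (\<rho> - (x - q) \<bullet> (x - q))" for x
  define A' where "A' x h = (- 2 * c x * ((x - q) \<bullet> h)) *\<^sub>R k" for x h
  have der: "((\<lambda>x. (max 0 (\<rho> - (x - q) \<bullet> (x - q)))\<^sup>2 *\<^sub>R k) has_derivative A' x) (at x)" for x
  proof -
    have "((\<lambda>x. \<rho> - (x - q) \<bullet> (x - q)) has_derivative (\<lambda>h. - 2 * ((x - q) \<bullet> h))) (at x)"
      by (auto intro!: derivative_eq_intros simp: inner_commute)
    from has_derivative_compose[OF this pos_part_square_has_derivative[unfolded has_field_derivative_def]]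
    have "((\<lambda>x. (max 0 (\<rho> - (x - q) \<bullet> (x - q)))\<^sup>2) has_derivative (\<lambda>h. - 2 * c x * ((x - q) \<bullet> h))) (at x)"
      by (rule has_derivative_eq_rhs) (simp add: c_def fun_eq_iff)
    then show ?thesis unfolding A'_def by (rule has_derivative_scaleR_left)
  qed
  have cont: "continuous_on S (\<lambda>z. A' (fst z) (snd z))" for S
    unfolding A'_def c_def by (intro continuous_intros)
  obtain C where C: "C > 0" "\<And>x. x \<in> cball 0 R \<Longrightarrow> norm ((2 * c x) *\<^sub>R (x - q)) \<le> C"
    by (rule compact_norm_upper_bound[OF compact_cball, of 0 R "\<lambda>x. (2 * c x) *\<^sub>R (x - q)"])
      (auto simp: c_def intro!: continuous_intros)
  have "\<bar>A' x h \<bullet> y - A' x y \<bullet> h\<bar> \<le> (2 * C * norm k) * norm h * norm y" if "norm x \<le> R" for x h y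
  proof -
    have *: "\<bar>A' x h \<bullet> y\<bar> \<le> C * norm k * norm h * norm y" for h y
    proof -
      have "\<bar>((2 * c x) *\<^sub>R (x - q)) \<bullet> h\<bar> * \<bar>k \<bullet> y\<bar> \<le> (C * norm h) * (norm k * norm y)"
      proof (rule mult_mono)
        have "\<bar>((2 * c x) *\<^sub>R (x - q)) \<bullet> h\<bar> \<le> norm ((2 * c x) *\<^sub>R (x - q)) * norm h"
          by (rule Cauchy_Schwarz_ineq2)
        also have "\<dots> \<le> C * norm h" using C(2)[of x] that by (intro mult_right_mono) auto
        finally show "\<bar>((2 * c x) *\<^sub>R (x - q)) \<bullet> h\<bar> \<le> C * norm h" .
      qed (use C(1) Cauchy_Schwarz_ineq2 in auto)
      moreover have "\<bar>A' x h \<bullet> y\<bar> = \<bar>((2 * c x) *\<^sub>R (x - q)) \<bullet> h\<bar> * \<bar>k \<bullet> y\<bar>"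
        unfolding A'_def by (simp add: abs_mult)
      ultimately show ?thesis by (simp add: mult_ac)
    qed
    have "C * norm k * norm y * norm h = C * norm k * norm h * norm y" by simp
    with *[of h y] *[of y h] show ?thesis by linarith
  qed
  then show ?thesis
    using der cont[of UNIV] C(1) unfolding curl_bounded_def
    by (intro exI[of _ "2 * C * norm k"]) auto
qed

subsection \<open>Loops of critical arcs\<close>

text \<open>Near \<open>q\<close> the set is a graph over the line \<open>k\<close>, parametrised by
  the \<open>k\<close>-coordinate. Bounding the speed, instead of asking \<open>k\<close> to be
  tangent at \<open>q\<close>, allows the centre to be moved along the arc with the same
  \<open>k\<close>.\<close>

definition arc_chart ::
  "(real ^ 'n) set \<Rightarrow> real \<Rightarrow> real ^ 'n \<Rightarrow> real ^ 'n \<Rightarrow> (real \<Rightarrow> real ^ 'n) \<Rightarrow> bool" where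
  "arc_chart S \<delta> q k \<alpha> \<longleftrightarrow> norm k = 1
     \<and> (\<forall>s. \<bar>s\<bar> < \<delta> \<longrightarrow> \<alpha> s \<in> S \<and> k \<bullet> (\<alpha> s - q) = s
          \<and> (\<exists>v. (\<alpha> has_vector_derivative v) (at s) \<and> norm v \<le> 11 / 10))
     \<and> (\<forall>x\<in>S. norm (x - q) < \<delta> \<longrightarrow> x = \<alpha> (k \<bullet> (x - q)))"

lemma inner_unit_le: "norm k = 1 \<Longrightarrow> \<bar>k \<bullet> u\<bar> \<le> norm u" for k :: "'a::real_inner"
  using Cauchy_Schwarz_ineq2[of k u] by simp

lemma arc_chart_shift:
  assumes "arc_chart S \<delta> p k \<alpha>" "q \<in> S" "norm (q - p) + \<epsilon> \<le> \<delta>" "\<epsilon> > 0"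
  shows "arc_chart S \<epsilon> q k (\<lambda>s. \<alpha> (k \<bullet> (q - p) + s))"
proof -
  have k: "norm k = 1" using assms(1) by (simp add: arc_chart_def)
  have kq: "\<bar>k \<bullet> (q - p)\<bar> \<le> norm (q - p)" by (rule inner_unit_le[OF k])
  have q: "q = \<alpha> (k \<bullet> (q - p))" using assms by (simp add: arc_chart_def)
  have 1: "\<alpha> (k \<bullet> (q - p) + s) \<in> S \<and> k \<bullet> (\<alpha> (k \<bullet> (q - p) + s) - q) = s
      \<and> (\<exists>v. ((\<lambda>s. \<alpha> (k \<bullet> (q - p) + s)) has_vector_derivative v) (at s) \<and> norm v \<le> 11 / 10)"
    if "\<bar>s\<bar> < \<epsilon>" for s
  proof -
    define t where "t = k \<bullet> (q - p) + s"
    have "\<bar>t\<bar> < \<delta>" using that kq assms(3) by (simp add: t_def)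
    then obtain v where v: "\<alpha> t \<in> S" "k \<bullet> (\<alpha> t - p) = t"
      "(\<alpha> has_vector_derivative v) (at t)" "norm v \<le> 11 / 10"
      using assms(1) unfolding arc_chart_def by blast
    have "((\<lambda>s. \<alpha> (k \<bullet> (q - p) + s)) has_vector_derivative 1 *\<^sub>R v) (at s)"
      by (rule vector_diff_chain_at[of "\<lambda>s. k \<bullet> (q - p) + s" 1 s \<alpha> v, unfolded o_def])
        (use v(3) in \<open>auto intro!: derivative_eq_intros simp: t_def\<close>)
    moreover have "k \<bullet> (\<alpha> t - q) = s"
      using v(2) by (simp add: inner_diff_right t_def)
    ultimately show ?thesis using v(1,4) by (auto simp: t_def)
  qed
  have 2: "x = \<alpha> (k \<bullet> (q - p) + k \<bullet> (x - q))" if "x \<in> S" "norm (x - q) < \<epsilon>" for x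
  proof -
    have "norm (x - p) < \<delta>" using norm_triangle_ineq[of "x - q" "q - p"] that(2) assms(3) by simp
    then have "x = \<alpha> (k \<bullet> (x - p))" using assms(1) that(1) unfolding arc_chart_def by blast
    also have "k \<bullet> (x - p) = k \<bullet> (q - p) + k \<bullet> (x - q)" by (simp add: inner_diff_right)
    finally show ?thesis .
  qed
  show ?thesis unfolding arc_chart_def using k 1 2 by blast
qed

text \<open>Half of a Lebesgue number of the cover by chart balls, with charts recentred by
  \<open>arc_chart_shift\<close>. The radius 2 \<tau> leaves room for a step of parameter length
  \<tau>, which moves by at most 11/10 \<tau>.\<close>

lemma uniform_arc_charts:
  assumes "compact S" "\<And>p. p \<in> S \<Longrightarrow> \<exists>\<delta>>0. \<exists>k \<alpha>. arc_chart S \<delta> p k \<alpha>"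
  obtains \<tau> where "\<tau> > 0" "\<And>q. q \<in> S \<Longrightarrow> \<exists>k \<alpha>. arc_chart S (2 * \<tau>) q k \<alpha>"
proof -
  define B where "B = {ball p \<delta> | p \<delta>. 0 < \<delta> \<and> (\<exists>k \<alpha>. arc_chart S \<delta> p k \<alpha>)}"
  have "S \<subseteq> \<Union> B"
  proof
    fix p assume "p \<in> S"
    then obtain \<delta> where "\<delta> > 0" "\<exists>k \<alpha>. arc_chart S \<delta> p k \<alpha>" using assms(2) by blast
    then have "ball p \<delta> \<in> B" "p \<in> ball p \<delta>" by (auto simp: B_def)
    then show "p \<in> \<Union> B" by blast
  qed
  moreover have "open G" if "G \<in> B" for G using that by (auto simp: B_def)
  ultimately obtain e where e: "e > 0" "\<And>x. x \<in> S \<Longrightarrow> \<exists>G\<in>B. ball x e \<subseteq> G"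
    using Heine_Borel_lemma[OF assms(1)] by metis
  show thesis
  proof (rule that[of "e / 2"])
    fix q assume q: "q \<in> S"
    then obtain p \<delta> k \<alpha> where p: "ball q e \<subseteq> ball p \<delta>" "arc_chart S \<delta> p k \<alpha>"
      using e(2)[OF q] by (auto simp: B_def)
    have "norm (q - p) + e \<le> \<delta>"
      using p(1) e(1) by (auto simp: ball_subset_ball_iff dist_norm)
    from arc_chart_shift[OF p(2) q this e(1)]
    show "\<exists>k \<alpha>. arc_chart S (2 * (e / 2)) q k \<alpha>" by auto
  qed (use e in simp)
qed

lemma arc_chart_dist:
  assumes "arc_chart S \<delta> q k \<alpha>" "\<bar>s\<bar> < \<delta>" "\<bar>t\<bar> < \<delta>"
  shows "\<bar>s - t\<bar> \<le> norm (\<alpha> s - \<alpha> t)" "norm (\<alpha> s - \<alpha> t) \<le> 11 / 10 * \<bar>s - t\<bar>"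
proof -
  have k: "norm k = 1" and ch: "\<And>s. \<bar>s\<bar> < \<delta> \<Longrightarrow> \<alpha> s \<in> S \<and> k \<bullet> (\<alpha> s - q) = s
          \<and> (\<exists>v. (\<alpha> has_vector_derivative v) (at s) \<and> norm v \<le> 11 / 10)"
    using assms(1) unfolding arc_chart_def by blast+
  have "k \<bullet> (\<alpha> s - \<alpha> t) = s - t"
    using ch[OF assms(2)] ch[OF assms(3)] by (simp add: inner_diff_right)
  then show "\<bar>s - t\<bar> \<le> norm (\<alpha> s - \<alpha> t)" using inner_unit_le[OF k] by metis
  obtain v where v: "\<And>u. \<bar>u\<bar> < \<delta> \<Longrightarrow> (\<alpha> has_vector_derivative v u) (at u) \<and> norm (v u) \<le> 11 / 10"
    using ch by metis
  have "norm (\<alpha> s - \<alpha> t) \<le> 11 / 10 * norm (s - t)"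
  proof (rule differentiable_bound[of "ball 0 \<delta>" \<alpha> "\<lambda>u x. x *\<^sub>R v u"])
    fix u :: real assume u: "u \<in> ball 0 \<delta>"
    then show "(\<alpha> has_derivative (\<lambda>x. x *\<^sub>R v u)) (at u within ball 0 \<delta>)"
      using v[of u] by (auto simp: has_vector_derivative_def intro: has_derivative_at_withinI)
    show "onorm (\<lambda>x. x *\<^sub>R v u) \<le> 11 / 10"
    proof (rule onorm_le)
      show "norm (x *\<^sub>R v u) \<le> 11 / 10 * norm x" for x
        using mult_left_mono[of "norm (v u)" "11 / 10" "\<bar>x\<bar>"] u v[of u] by simp
    qed
  qed (use assms in auto)
  then show "norm (\<alpha> s - \<alpha> t) \<le> 11 / 10 * \<bar>s - t\<bar>" by simp
qed

lemma arc_chart_zero: "arc_chart S \<delta> q k \<alpha> \<Longrightarrow> q \<in> S \<Longrightarrow> \<delta> > 0 \<Longrightarrow> \<alpha> 0 = q"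
  unfolding arc_chart_def by fastforce

lemma deriv_lower_bound:
  fixes f :: "real \<Rightarrow> real"
  assumes "a \<le> b" "\<And>s. a \<le> s \<Longrightarrow> s \<le> b \<Longrightarrow> (f has_real_derivative f' s) (at s)"
    "\<And>s. a \<le> s \<Longrightarrow> s \<le> b \<Longrightarrow> m \<le> f' s"
  shows "m * (b - a) \<le> f b - f a"
proof (cases "a = b")
  case False
  then obtain z where z: "a < z" "z < b" "f b - f a = (b - a) * f' z"
    using MVT2[of a b f f'] assms(1,2) by auto
  then have "m \<le> f' z" using assms(3) by simp
  then show ?thesis unfolding z(3) using assms(1) by (simp add: mult.commute[of _ "b - a"] mult_left_mono)
qed simp

lemma deriv_abs_bound:
  fixes f :: "real \<Rightarrow> real"
  assumes "\<And>s. min a b \<le> s \<Longrightarrow> s \<le> max a b \<Longrightarrow> (f has_real_derivative f' s) (at s) \<and> \<bar>f' s\<bar> \<le> m"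
  shows "\<bar>f b - f a\<bar> \<le> m * \<bar>b - a\<bar>"
proof -
  have "norm (f b - f a) \<le> m * norm (b - a)"
  proof (rule field_differentiable_bound[of "{min a b..max a b}" f f'])
    fix z assume "z \<in> {min a b..max a b}"
    then show "(f has_real_derivative f' z) (at z within {min a b..max a b})" "norm (f' z) \<le> m"
      using assms[of z] has_field_derivative_at_within by auto
  qed auto
  then show ?thesis by simp
qed

text \<open>The 1-form \<open>\<phi> (k \<bullet> dx)\<close> is \<open>d\<Phi>\<close> up to an error \<open>\<eta>\<close>, but only along \<open>S\<close>.\<close>

definition tangential_primitive ::
  "(real ^ 'n) set \<Rightarrow> real \<Rightarrow> (real ^ 'n \<Rightarrow> real) \<Rightarrow> real ^ 'n \<Rightarrow> (real ^ 'n \<Rightarrow> real) \<Rightarrow> bool" where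
  "tangential_primitive S \<eta> \<phi> k \<Phi> \<longleftrightarrow> (\<forall>\<delta> q k' \<alpha> s v. arc_chart S \<delta> q k' \<alpha> \<longrightarrow> \<bar>s\<bar> < \<delta> \<longrightarrow>
     (\<alpha> has_vector_derivative v) (at s) \<longrightarrow>
     (\<exists>d. ((\<lambda>s. \<Phi> (\<alpha> s)) has_real_derivative d) (at s) \<and> \<bar>d - \<phi> (\<alpha> s) * (k \<bullet> v)\<bar> \<le> \<eta> * norm v))"

text \<open>Differentiating the coordinate identity of the chart gives
  \<open>k' \<bullet> v s = 1\<close>. In a chart with \<open>k' = k\<close> the bump form is thus
  \<phi> ds.\<close>

lemma tangential_primitive_along:
  assumes "tangential_primitive S \<eta> \<phi> k \<Phi>" "arc_chart S \<delta> q k' \<alpha>" "\<eta> \<ge> 0"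
  obtains v d where "\<And>s. \<bar>s\<bar> < \<delta> \<Longrightarrow> k' \<bullet> v s = 1"
    "\<And>s. \<bar>s\<bar> < \<delta> \<Longrightarrow> ((\<lambda>s. \<Phi> (\<alpha> s)) has_real_derivative d s) (at s)"
    "\<And>s. \<bar>s\<bar> < \<delta> \<Longrightarrow> \<bar>d s - \<phi> (\<alpha> s) * (k \<bullet> v s)\<bar> \<le> 11 / 10 * \<eta>"
proof -
  have ch: "\<And>s. \<bar>s\<bar> < \<delta> \<Longrightarrow> k' \<bullet> (\<alpha> s - q) = s
          \<and> (\<exists>v. (\<alpha> has_vector_derivative v) (at s) \<and> norm v \<le> 11 / 10)"
    using assms(2) unfolding arc_chart_def by blast
  then obtain v where v: "\<And>s. \<bar>s\<bar> < \<delta> \<Longrightarrow> (\<alpha> has_vector_derivative v s) (at s) \<and> norm (v s) \<le> 11 / 10"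
    by metis
  then have "\<exists>d. ((\<lambda>s. \<Phi> (\<alpha> s)) has_real_derivative d) (at s) \<and>
      \<bar>d - \<phi> (\<alpha> s) * (k \<bullet> v s)\<bar> \<le> \<eta> * norm (v s)" if "\<bar>s\<bar> < \<delta>" for s
    using assms(1,2) that unfolding tangential_primitive_def by blast
  then obtain d where d: "\<And>s. \<bar>s\<bar> < \<delta> \<Longrightarrow> ((\<lambda>s. \<Phi> (\<alpha> s)) has_real_derivative d s) (at s) \<and>
      \<bar>d s - \<phi> (\<alpha> s) * (k \<bullet> v s)\<bar> \<le> \<eta> * norm (v s)" by metis
  show thesis
  proof (rule that[of v d])
    fix s assume s: "\<bar>s\<bar> < \<delta>"
    show "((\<lambda>s. \<Phi> (\<alpha> s)) has_real_derivative d s) (at s)" using d s by blast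
    show "\<bar>d s - \<phi> (\<alpha> s) * (k \<bullet> v s)\<bar> \<le> 11 / 10 * \<eta>"
      using d[OF s] v[OF s] assms(3) mult_left_mono[of "norm (v s)" "11 / 10" \<eta>] by simp
    have "((\<lambda>s. k' \<bullet> (\<alpha> s - q)) has_vector_derivative k' \<bullet> v s) (at s)"
      by (rule bounded_linear.has_vector_derivative[OF bounded_linear_inner_right])
        (use v[OF s] in \<open>auto intro!: derivative_eq_intros\<close>)
    moreover have "((\<lambda>s. k' \<bullet> (\<alpha> s - q)) has_vector_derivative 1) (at s)"
      by (rule has_vector_derivative_transform_within_open[OF has_vector_derivative_id, of "ball 0 \<delta>"])
        (use ch s in auto)
    ultimately show "k' \<bullet> v s = 1" by (rule vector_derivative_unique_at)
  qed
qed

lemma increment_off_support: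
  assumes "tangential_primitive S \<eta> \<phi> k \<Phi>" "arc_chart S \<delta> q k' \<alpha>" "\<eta> \<ge> 0"
    and "\<bar>a\<bar> < \<delta>" "\<bar>b\<bar> < \<delta>" "\<And>s. min a b \<le> s \<Longrightarrow> s \<le> max a b \<Longrightarrow> \<phi> (\<alpha> s) = 0"
  shows "\<bar>\<Phi> (\<alpha> b) - \<Phi> (\<alpha> a)\<bar> \<le> 11 / 10 * \<eta> * \<bar>b - a\<bar>"
proof -
  obtain v d where d: "\<And>s. \<bar>s\<bar> < \<delta> \<Longrightarrow> ((\<lambda>s. \<Phi> (\<alpha> s)) has_real_derivative d s) (at s)"
    "\<And>s. \<bar>s\<bar> < \<delta> \<Longrightarrow> \<bar>d s - \<phi> (\<alpha> s) * (k \<bullet> v s)\<bar> \<le> 11 / 10 * \<eta>"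
    by (rule tangential_primitive_along[OF assms(1-3)]) blast
  show ?thesis
  proof (rule deriv_abs_bound[of a b "\<lambda>s. \<Phi> (\<alpha> s)" d])
    fix s assume s: "min a b \<le> s" "s \<le> max a b"
    then have "\<bar>s\<bar> < \<delta>" using assms(4,5) by linarith
    then show "((\<lambda>s. \<Phi> (\<alpha> s)) has_real_derivative d s) (at s) \<and> \<bar>d s\<bar> \<le> 11 / 10 * \<eta>"
      using d[of s] assms(6)[OF s] by simp
  qed
qed

text \<open>The chart has the direction \<open>k\<close> of the form, so the integrand is \<phi> >=
  0 and nothing cancels. The middle interval of length 2 \<sigma> supplies the gain.\<close>

lemma increment_across:
  assumes "tangential_primitive S \<eta> \<phi> k \<Phi>" "arc_chart S \<delta> q k \<alpha>" "\<eta> \<ge> 0"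
    and ab: "- \<delta> < a" "a \<le> - \<sigma>" "0 < \<sigma>" "\<sigma> \<le> b" "b < \<delta>"
    and \<phi>: "\<And>x. 0 \<le> \<phi> x" "\<And>s. \<bar>s\<bar> \<le> \<sigma> \<Longrightarrow> c \<le> \<phi> (\<alpha> s)"
  shows "2 * \<sigma> * c - 11 / 10 * \<eta> * (b - a) \<le> \<Phi> (\<alpha> b) - \<Phi> (\<alpha> a)"
proof -
  obtain v d where v: "\<And>s. \<bar>s\<bar> < \<delta> \<Longrightarrow> k \<bullet> v s = 1"
    and d: "\<And>s. \<bar>s\<bar> < \<delta> \<Longrightarrow> ((\<lambda>s. \<Phi> (\<alpha> s)) has_real_derivative d s) (at s)"
    "\<And>s. \<bar>s\<bar> < \<delta> \<Longrightarrow> \<bar>d s - \<phi> (\<alpha> s) * (k \<bullet> v s)\<bar> \<le> 11 / 10 * \<eta>"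
    by (rule tangential_primitive_along[OF assms(1-3)]) blast
  have lb: "\<phi> (\<alpha> s) - 11 / 10 * \<eta> \<le> d s" if "\<bar>s\<bar> < \<delta>" for s
    using d(2)[OF that] unfolding v[OF that] mult_1_right by linarith
  have lb0: "- (11 / 10 * \<eta>) \<le> d s" if "\<bar>s\<bar> < \<delta>" for s
    using lb[OF that] \<phi>(1)[of "\<alpha> s"] by linarith
  have "- (11 / 10 * \<eta>) * (- \<sigma> - a) \<le> \<Phi> (\<alpha> (- \<sigma>)) - \<Phi> (\<alpha> a)"
    by (rule deriv_lower_bound[of _ _ "\<lambda>s. \<Phi> (\<alpha> s)" d]) (use ab d(1) lb0 in auto)
  moreover have "(c - 11 / 10 * \<eta>) * (\<sigma> - - \<sigma>) \<le> \<Phi> (\<alpha> \<sigma>) - \<Phi> (\<alpha> (- \<sigma>))"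
  proof (rule deriv_lower_bound[of _ _ "\<lambda>s. \<Phi> (\<alpha> s)" d])
    fix s assume "- \<sigma> \<le> s" "s \<le> \<sigma>"
    then have s: "\<bar>s\<bar> \<le> \<sigma>" "\<bar>s\<bar> < \<delta>" using ab by auto
    show "((\<lambda>s. \<Phi> (\<alpha> s)) has_real_derivative d s) (at s)" using d(1) s(2) .
    show "c - 11 / 10 * \<eta> \<le> d s" using lb[OF s(2)] \<phi>(2)[OF s(1)] by linarith
  qed (use ab in simp)
  moreover have "- (11 / 10 * \<eta>) * (b - \<sigma>) \<le> \<Phi> (\<alpha> b) - \<Phi> (\<alpha> \<sigma>)"
    by (rule deriv_lower_bound[of _ _ "\<lambda>s. \<Phi> (\<alpha> s)" d]) (use ab d(1) lb0 in auto)
  moreover define e where "e = 11 / 10 * \<eta>"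
  ultimately show ?thesis unfolding e_def[symmetric] by (simp add: algebra_simps)
qed

text \<open>Compactness forces a near return. The least \<open>j\<close>, and then the largest
  \<open>i\<close>, give a near loop that contains no shorter one.\<close>

lemma first_return:
  fixes p :: "nat \<Rightarrow> 'a::metric_space"
  assumes S: "compact S" "\<And>m. p m \<in> S" and c: "c > 0"
  obtains i j where "i < j" "dist (p i) (p j) < c"
    "\<And>a b. a < b \<Longrightarrow> b < j \<Longrightarrow> c \<le> dist (p a) (p b)"
    "\<And>l. i < l \<Longrightarrow> l < j \<Longrightarrow> c \<le> dist (p l) (p j)"
proof -
  obtain x \<sigma> where \<sigma>: "strict_mono \<sigma>" "(p \<circ> \<sigma>) \<longlonglongrightarrow> x"
    using S unfolding compact_def by metis
  from LIMSEQ_imp_Cauchy[OF \<sigma>(2)] c obtain N where "\<And>m n. m \<ge> N \<Longrightarrow> n \<ge> N \<Longrightarrow> dist ((p \<circ> \<sigma>) m) ((p \<circ> \<sigma>) n) < c"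
    unfolding Cauchy_def by blast
  then have "dist (p (\<sigma> N)) (p (\<sigma> (Suc N))) < c" by simp
  moreover have "\<sigma> N < \<sigma> (Suc N)" using \<sigma>(1) by (simp add: strict_mono_def)
  ultimately have ex: "\<exists>j. \<exists>i<j. dist (p i) (p j) < c" by blast
  define j where "j = (LEAST j. \<exists>i<j. dist (p i) (p j) < c)"
  have j: "\<exists>i<j. dist (p i) (p j) < c" unfolding j_def by (rule LeastI_ex[OF ex])
  define I where "I = {i. i < j \<and> dist (p i) (p j) < c}"
  have I: "finite I" "I \<noteq> {}" using j by (auto simp: I_def)
  show thesis
  proof (rule that[of "Max I" j])
    show "Max I < j" "dist (p (Max I)) (p j) < c" using Max_in[OF I] by (auto simp: I_def)
    show "c \<le> dist (p a) (p b)" if "a < b" "b < j" for a b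
      using not_less_Least[of b "\<lambda>j. \<exists>i<j. dist (p i) (p j) < c"] that unfolding j_def by force
    show "c \<le> dist (p l) (p j)" if "Max I < l" "l < j" for l
    proof (rule ccontr)
      assume "\<not> c \<le> dist (p l) (p j)"
      then have "l \<in> I" using that(2) by (simp add: I_def)
      then show False using Max_ge[OF I(1)] that(1) by fastforce
    qed
  qed
qed

text \<open>The condition \<open>s * t < 0\<close> puts the previous and the next point on opposite
  sides of the current one. The walk never turns back, so it really crosses each point it
  visits.\<close>

lemma forward_chain:
  assumes "S \<noteq> {}" and \<tau>: "\<tau> > 0" "\<And>q. q \<in> S \<Longrightarrow> \<exists>k \<alpha>. arc_chart S (2 * \<tau>) q k \<alpha>"
  obtains p where "\<And>m. p m \<in> S"
    "\<And>m. \<exists>k \<alpha> s t. arc_chart S (2 * \<tau>) (p (Suc m)) k \<alpha> \<and> p m = \<alpha> s \<and> p (Suc (Suc m)) = \<alpha> t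
       \<and> \<bar>t\<bar> = \<tau> \<and> \<bar>s\<bar> < 2 * \<tau> \<and> s * t < 0"
    "\<And>m. \<tau> \<le> norm (p m - p (Suc m)) \<and> norm (p m - p (Suc m)) \<le> 11 / 10 * \<tau>"
proof -
  define adj where "adj u q \<longleftrightarrow> u \<in> S \<and> q \<in> S \<and> \<tau> \<le> norm (u - q) \<and> norm (u - q) \<le> 11 / 10 * \<tau>" for u q
  define fwd where "fwd u q q' \<longleftrightarrow> (\<exists>k \<alpha> s t. arc_chart S (2 * \<tau>) q k \<alpha> \<and> u = \<alpha> s \<and> q' = \<alpha> t
       \<and> \<bar>t\<bar> = \<tau> \<and> \<bar>s\<bar> < 2 * \<tau> \<and> s * t < 0)" for u q q'
  have far: "adj q (\<alpha> t)" if "q \<in> S" "arc_chart S (2 * \<tau>) q k \<alpha>" "\<bar>t\<bar> = \<tau>" for q k \<alpha> t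
  proof -
    have "\<alpha> t \<in> S" using that \<tau>(1) by (simp add: arc_chart_def)
    moreover have "\<alpha> 0 = q" using arc_chart_zero[OF that(2,1)] \<tau>(1) by simp
    ultimately show ?thesis
      using arc_chart_dist[OF that(2), of 0 t] that(1,3) \<tau>(1) by (simp add: adj_def)
  qed
  have step: "\<exists>q'. adj q q' \<and> fwd u q q'" if "adj u q" for u q
  proof -
    have uq: "u \<in> S" "q \<in> S" "\<tau> \<le> norm (u - q)" "norm (u - q) < 2 * \<tau>"
      using that \<tau>(1) by (auto simp: adj_def)
    obtain k \<alpha> where ch: "arc_chart S (2 * \<tau>) q k \<alpha>" using \<tau>(2)[OF uq(2)] by blast
    define s where "s = k \<bullet> (u - q)"
    have u: "u = \<alpha> s" using ch uq unfolding arc_chart_def s_def by blast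
    have "norm k = 1" using ch by (simp add: arc_chart_def)
    then have s: "\<bar>s\<bar> < 2 * \<tau>" using inner_unit_le[of k "u - q"] uq(4) by (simp add: s_def)
    have "\<alpha> 0 = q" using arc_chart_zero[OF ch uq(2)] \<tau>(1) by simp
    then have "s \<noteq> 0" using u uq(3) \<tau>(1) by auto
    then have "\<exists>t. \<bar>t\<bar> = \<tau> \<and> s * t < 0"
      using \<tau>(1) by (intro exI[of _ "if s < 0 then \<tau> else - \<tau>"]) (auto simp: mult_neg_pos mult_pos_neg)
    then obtain t where t: "\<bar>t\<bar> = \<tau>" "s * t < 0" by blast
    show ?thesis
      using far[OF uq(2) ch t(1)] ch u s t unfolding fwd_def by blast
  qed
  obtain q0 where q0: "q0 \<in> S" using assms(1) by blast
  obtain k \<alpha> where "arc_chart S (2 * \<tau>) q0 k \<alpha>" using \<tau>(2)[OF q0] by blast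
  then have start: "adj q0 (\<alpha> \<tau>)" using far[OF q0] \<tau>(1) by simp
  \<comment> \<open>The state is a pair of consecutive points, because the forward side at a point
    is determined by its predecessor.\<close>
  have "\<exists>f. \<forall>n. (case f n of (u, q) \<Rightarrow> adj u q) \<and>
      (case f n of (u, q) \<Rightarrow> case f (Suc n) of (u', q') \<Rightarrow> u' = q \<and> fwd u q q')"
  proof (rule dependent_nat_choice)
    show "\<exists>x. case x of (u, q) \<Rightarrow> adj u q" using start by blast
    fix x :: "(real ^ 'a) \<times> (real ^ 'a)"
    assume "case x of (u, q) \<Rightarrow> adj u q"
    then show "\<exists>y. (case y of (u, q) \<Rightarrow> adj u q) \<and>
       (case x of (u, q) \<Rightarrow> case y of (u', q') \<Rightarrow> u' = q \<and> fwd u q q')"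
      using step by (cases x) fastforce
  qed
  then obtain f where f: "\<And>n. adj (fst (f n)) (snd (f n))"
      "\<And>n. fst (f (Suc n)) = snd (f n)" "\<And>n. fwd (fst (f n)) (snd (f n)) (snd (f (Suc n)))"
    by (auto simp: split_beta)
  show thesis
  proof (rule that[of "\<lambda>m. fst (f m)"])
    show "fst (f m) \<in> S" for m using f(1) by (simp add: adj_def)
    show "\<tau> \<le> norm (fst (f m) - fst (f (Suc m))) \<and> norm (fst (f m) - fst (f (Suc m))) \<le> 11 / 10 * \<tau>" for m
      using f(1)[of m] unfolding f(2) by (simp add: adj_def)
    show "\<exists>k \<alpha> s t. arc_chart S (2 * \<tau>) (fst (f (Suc m))) k \<alpha> \<and> fst (f m) = \<alpha> s \<and> fst (f (Suc (Suc m))) = \<alpha> t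
       \<and> \<bar>t\<bar> = \<tau> \<and> \<bar>s\<bar> < 2 * \<tau> \<and> s * t < 0" for m
      using f(3)[of m] unfolding f(2) fwd_def .
  qed
qed

text \<open>Each point of the piece is within parameter \<tau>/2, hence within distance 11/20
  \<tau>, of one of its ends. It is therefore at least (6/10 - 11/20) \<tau> = \<tau>/20 away from
  \<open>q0\<close>, outside the support of the bump.\<close>

lemma increment_avoiding:
  assumes tp: "tangential_primitive S \<eta> (\<lambda>x. (max 0 ((\<tau> / 20)\<^sup>2 - (x - q0) \<bullet> (x - q0)))\<^sup>2) k \<Phi>"
    and ch: "arc_chart S (2 * \<tau>) q k' \<alpha>" and "q \<in> S" "\<tau> > 0" "\<eta> \<ge> 0" "\<bar>t\<bar> \<le> \<tau>"
    and far: "6 / 10 * \<tau> \<le> norm (q - q0)" "6 / 10 * \<tau> \<le> norm (\<alpha> t - q0)"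
  shows "\<bar>\<Phi> (\<alpha> t) - \<Phi> q\<bar> \<le> 11 / 10 * \<eta> * \<tau>"
proof -
  have a0: "\<alpha> 0 = q" using arc_chart_zero[OF ch assms(3)] assms(4) by simp
  have "\<bar>\<Phi> (\<alpha> t) - \<Phi> (\<alpha> 0)\<bar> \<le> 11 / 10 * \<eta> * \<bar>t - 0\<bar>"
  proof (rule increment_off_support[OF tp ch assms(5)])
    fix s assume s: "min 0 t \<le> s" "s \<le> max 0 t"
    have s1: "\<bar>s\<bar> < 2 * \<tau>" "\<bar>t\<bar> < 2 * \<tau>" "\<bar>0::real\<bar> < 2 * \<tau>" using s assms(4,6) by auto
    have "\<bar>s\<bar> \<le> \<tau> / 2 \<or> \<bar>s - t\<bar> \<le> \<tau> / 2" using s assms(6) by linarith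
    then have "\<tau> / 20 \<le> norm (\<alpha> s - q0)"
    proof
      assume "\<bar>s\<bar> \<le> \<tau> / 2"
      then have "norm (\<alpha> s - q) \<le> 11 / 20 * \<tau>"
        using arc_chart_dist(2)[OF ch s1(1,3)] by (simp add: a0)
      then show ?thesis
        using far(1) norm_triangle_ineq[of "q - \<alpha> s" "\<alpha> s - q0"] by (simp add: norm_minus_commute)
    next
      assume "\<bar>s - t\<bar> \<le> \<tau> / 2"
      then have "norm (\<alpha> s - \<alpha> t) \<le> 11 / 20 * \<tau>"
        using arc_chart_dist(2)[OF ch s1(1,2)] by simp
      then show ?thesis
        using far(2) norm_triangle_ineq[of "\<alpha> t - \<alpha> s" "\<alpha> s - q0"] by (simp add: norm_minus_commute)
    qed
    then have "(\<tau> / 20)\<^sup>2 \<le> (norm (\<alpha> s - q0))\<^sup>2" using assms(4) by (intro power_mono) auto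
    then show "(max 0 ((\<tau> / 20)\<^sup>2 - (\<alpha> s - q0) \<bullet> (\<alpha> s - q0)))\<^sup>2 = 0"
      by (simp add: power2_norm_eq_inner)
  qed (use assms(4,6) in auto)
  also have "\<dots> \<le> 11 / 10 * \<eta> * \<tau>" using assms(5,6) by (intro mult_left_mono) auto
  finally show ?thesis unfolding a0 .
qed

text \<open>
  With \<open>i < j\<close> the first near return of a forward chain, the bump sits at \<open>p (i + 1)\<close>. The
  thresholds \<open>6/10 \<tau>\<close> and \<open>\<tau> / 20\<close> guarantee that no other part of the closed-up chain
  meets the support of the bump.
\<close>

lemma no_compact_curve:
  fixes S :: "(real ^ 'n) set"
  assumes S: "compact S" "\<And>p. p \<in> S \<Longrightarrow> \<exists>\<delta>>0. \<exists>k \<alpha>. arc_chart S \<delta> p k \<alpha>"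
    and prim: "\<And>\<rho> q k \<eta>. \<eta> > 0 \<Longrightarrow>
      \<exists>\<Phi>. tangential_primitive S \<eta> (\<lambda>x. (max 0 (\<rho> - (x - q) \<bullet> (x - q)))\<^sup>2) k \<Phi>"
  shows "S = {}"
proof (rule ccontr)
  assume ne: "S \<noteq> {}"
  obtain \<tau> where \<tau>: "\<tau> > 0" "\<And>q. q \<in> S \<Longrightarrow> \<exists>k \<alpha>. arc_chart S (2 * \<tau>) q k \<alpha>"
    using uniform_arc_charts[OF S] by metis
  obtain p where pS: "\<And>m. p m \<in> S"
    and fwd: "\<And>m. \<exists>k \<alpha> s t. arc_chart S (2 * \<tau>) (p (Suc m)) k \<alpha> \<and> p m = \<alpha> s
       \<and> p (Suc (Suc m)) = \<alpha> t \<and> \<bar>t\<bar> = \<tau> \<and> \<bar>s\<bar> < 2 * \<tau> \<and> s * t < 0"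
    and adj: "\<And>m. \<tau> \<le> norm (p m - p (Suc m)) \<and> norm (p m - p (Suc m)) \<le> 11 / 10 * \<tau>"
    using forward_chain[OF ne \<tau>] by metis
  obtain i j where ij: "i < j" "dist (p i) (p j) < 6 / 10 * \<tau>"
    "\<And>a b. a < b \<Longrightarrow> b < j \<Longrightarrow> 6 / 10 * \<tau> \<le> dist (p a) (p b)"
    "\<And>l. i < l \<Longrightarrow> l < j \<Longrightarrow> 6 / 10 * \<tau> \<le> dist (p l) (p j)"
    by (rule first_return[of S p "6 / 10 * \<tau>"]) (use \<tau>(1) S(1) pS in auto)
  define l where "l = Suc i"
  have lj: "l < j"
  proof (rule ccontr)
    assume "\<not> l < j"
    then have "j = Suc i" using ij(1) by (simp add: l_def)
    then show False using ij(2) adj[of i] \<tau>(1) by (simp add: dist_norm)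
  qed
  have far: "6 / 10 * \<tau> \<le> norm (p m - p l)" if "m \<le> j" "m \<noteq> l" for m
  proof (cases "m = j")
    case True
    then show ?thesis using ij(4)[of l] lj by (simp add: l_def dist_norm norm_minus_commute)
  next
    case False
    then show ?thesis using ij(3)[of m l] ij(3)[of l m] that lj
      by (cases m l rule: linorder_cases) (auto simp: dist_norm norm_minus_commute)
  qed
  obtain k \<alpha> s t where ch: "arc_chart S (2 * \<tau>) (p l) k \<alpha>" and st: "p i = \<alpha> s" "p (Suc l) = \<alpha> t"
    "\<bar>t\<bar> = \<tau>" "\<bar>s\<bar> < 2 * \<tau>" "s * t < 0"
    using fwd[of i] unfolding l_def by blast
  define \<phi> where "\<phi> = (\<lambda>x. (max 0 ((\<tau> / 20)\<^sup>2 - (x - p l) \<bullet> (x - p l)))\<^sup>2)"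
  \<comment> \<open>For parameters up to \<sigma> the arc stays within 11/10 \<sigma> of
    \<open>p l\<close>. There the squared distance is at most half of (\<tau>/20)^2, so the bump is
    at least \<open>c\<close>.\<close>
  define \<sigma> where "\<sigma> = \<tau> / 40"
  define c where "c = ((\<tau> / 20)\<^sup>2 / 2)\<^sup>2"
  have c: "c > 0" using \<tau>(1) by (simp add: c_def)
  have \<sigma>: "\<sigma> > 0" using \<tau>(1) by (simp add: \<sigma>_def)
  \<comment> \<open>In units of 11/10 \<eta> \<tau> the errors around the loop are at most
    \<open>j\<close> for the ordinary steps, 3 for the crossing and 1 for the closing arc. This
    choice makes their sum \<open>\<sigma> * c\<close>, half of the gain.\<close>
  define \<eta> where "\<eta> = \<sigma> * c / (11 / 10 * \<tau> * (real j + 4))"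
  have \<eta>: "\<eta> > 0" using c \<sigma> \<tau>(1) by (simp add: \<eta>_def add_nonneg_pos)
  obtain \<Phi> where tp: "tangential_primitive S \<eta> \<phi> k \<Phi>" using prim[OF \<eta>] unfolding \<phi>_def by blast
  note tp' = tp[unfolded \<phi>_def]
  have a0: "\<alpha> 0 = p l" using arc_chart_zero[OF ch pS] \<tau>(1) by simp
  have \<phi>0: "0 \<le> \<phi> x" for x by (simp add: \<phi>_def)
  have \<phi>c: "c \<le> \<phi> (\<alpha> u)" if "\<bar>u\<bar> \<le> \<sigma>" for u
  proof -
    have "norm (\<alpha> u - p l) \<le> 11 / 10 * \<sigma>"
      using arc_chart_dist(2)[OF ch, of u 0] that \<tau>(1) by (simp add: a0 \<sigma>_def)
    then have "(\<alpha> u - p l) \<bullet> (\<alpha> u - p l) \<le> (11 / 10 * \<sigma>)\<^sup>2"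
      unfolding power2_norm_eq_inner[symmetric] by (intro power_mono) auto
    also have "\<dots> \<le> (\<tau> / 20)\<^sup>2 / 2" by (simp add: \<sigma>_def power2_eq_square)
    finally have "(\<tau> / 20)\<^sup>2 / 2 \<le> max 0 ((\<tau> / 20)\<^sup>2 - (\<alpha> u - p l) \<bullet> (\<alpha> u - p l))"
      by (intro max.coboundedI2) linarith
    then show ?thesis unfolding c_def \<phi>_def by (intro power_mono) auto
  qed
  have s: "\<sigma> \<le> \<bar>s\<bar>"
  proof -
    have "\<tau> \<le> norm (\<alpha> s - \<alpha> 0)" using adj[of i] by (simp add: st(1)[symmetric] a0 l_def)
    also have "\<dots> \<le> 11 / 10 * \<bar>s - 0\<bar>" using st(4) \<tau>(1) by (intro arc_chart_dist(2)[OF ch]) auto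
    finally show ?thesis using \<tau>(1) by (simp add: \<sigma>_def)
  qed
  \<comment> \<open>The chart at \<open>p l\<close> may be traversed in either direction, hence the
    absolute value. The parameter length is at most \<tau> + 2 \<tau>.\<close>
  have cross: "2 * \<sigma> * c - 11 / 10 * \<eta> * (3 * \<tau>) \<le> \<bar>\<Phi> (p (Suc l)) - \<Phi> (p i)\<bar>"
  proof (cases "s < 0")
    case True
    then have t: "t = \<tau>" using st(3,5) \<tau>(1) by (auto simp: mult_less_0_iff abs_if split: if_splits)
    have "2 * \<sigma> * c - 11 / 10 * \<eta> * (t - s) \<le> \<Phi> (\<alpha> t) - \<Phi> (\<alpha> s)"
      by (rule increment_across[OF tp ch less_imp_le[OF \<eta>] _ _ \<sigma> _ _ \<phi>0 \<phi>c])
        (use True s t st(4) \<tau>(1) in \<open>auto simp: \<sigma>_def\<close>)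
    moreover have "11 / 10 * \<eta> * (t - s) \<le> 11 / 10 * \<eta> * (3 * \<tau>)"
      using st(4) t \<eta> by (intro mult_left_mono) auto
    ultimately show ?thesis unfolding st(1,2) by linarith
  next
    case False
    then have t: "t = - \<tau>" using st(3,5) \<tau>(1) by (auto simp: mult_less_0_iff abs_if split: if_splits)
    have "2 * \<sigma> * c - 11 / 10 * \<eta> * (s - t) \<le> \<Phi> (\<alpha> s) - \<Phi> (\<alpha> t)"
      by (rule increment_across[OF tp ch less_imp_le[OF \<eta>] _ _ \<sigma> _ _ \<phi>0 \<phi>c])
        (use False s t st(4) \<tau>(1) in \<open>auto simp: \<sigma>_def\<close>)
    moreover have "11 / 10 * \<eta> * (s - t) \<le> 11 / 10 * \<eta> * (3 * \<tau>)"
      using st(4) t \<eta> by (intro mult_left_mono) auto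
    ultimately show ?thesis unfolding st(1,2) by linarith
  qed
  have chain: "\<bar>\<Phi> (p (Suc l + m)) - \<Phi> (p (Suc l))\<bar> \<le> real m * (11 / 10 * \<eta> * \<tau>)" if "Suc l + m \<le> j" for m
    using that
  proof (induction m)
    case (Suc m)
    obtain k' \<beta> t' where "arc_chart S (2 * \<tau>) (p (Suc (l + m))) k' \<beta>"
      "p (Suc (Suc (l + m))) = \<beta> t'" "\<bar>t'\<bar> = \<tau>"
      using fwd[of "l + m"] by blast
    then have "\<bar>\<Phi> (\<beta> t') - \<Phi> (p (Suc (l + m)))\<bar> \<le> 11 / 10 * \<eta> * \<tau>"
      using far[of "Suc (l + m)"] far[of "Suc (Suc (l + m))"] Suc.prems \<eta> \<tau>(1) pS
      by (intro increment_avoiding[OF tp']) auto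
    then have "\<bar>\<Phi> (p (Suc l + Suc m)) - \<Phi> (p (Suc l + m))\<bar> \<le> 11 / 10 * \<eta> * \<tau>"
      using \<open>p (Suc (Suc (l + m))) = \<beta> t'\<close> by simp
    moreover have "\<bar>\<Phi> (p (Suc l + m)) - \<Phi> (p (Suc l))\<bar> \<le> real m * (11 / 10 * \<eta> * \<tau>)"
      using Suc by simp
    moreover have "real (Suc m) * (11 / 10 * \<eta> * \<tau>) = real m * (11 / 10 * \<eta> * \<tau>) + 11 / 10 * \<eta> * \<tau>"
      by (simp add: algebra_simps)
    ultimately show ?case by linarith
  qed simp
  \<comment> \<open>The near return puts \<open>p i\<close> into the chart at \<open>p j\<close>, so
    a short piece of that arc closes the loop.\<close>
  have close: "\<bar>\<Phi> (p i) - \<Phi> (p j)\<bar> \<le> 11 / 10 * \<eta> * \<tau>"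
  proof -
    obtain k' \<beta> where ch': "arc_chart S (2 * \<tau>) (p j) k' \<beta>" using \<tau>(2)[OF pS] by blast
    have d: "norm (p i - p j) < 6 / 10 * \<tau>" using ij(2) by (simp add: dist_norm)
    define u where "u = k' \<bullet> (p i - p j)"
    have u: "p i = \<beta> u" "norm k' = 1" using ch' pS d \<tau>(1) unfolding arc_chart_def u_def by auto
    have "\<bar>u\<bar> \<le> \<tau>" using inner_unit_le[OF u(2), of "p i - p j"] d \<tau>(1) by (simp add: u_def)
    then show ?thesis
      using far[of i] far[of j] lj \<eta> \<tau>(1) pS u(1) unfolding u(1)
      by (intro increment_avoiding[OF tp' ch']) (auto simp: l_def)
  qed
  have "Suc l + (j - Suc l) = j" using lj by simp
  with chain[of "j - Suc l"]
  have "\<bar>\<Phi> (p j) - \<Phi> (p (Suc l))\<bar> \<le> real (j - Suc l) * (11 / 10 * \<eta> * \<tau>)" by simp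
  also have "\<dots> \<le> real j * (11 / 10 * \<eta> * \<tau>)" using \<eta> \<tau>(1) by (intro mult_right_mono) auto
  finally have "\<bar>\<Phi> (p j) - \<Phi> (p (Suc l))\<bar> \<le> real j * (11 / 10 * \<eta> * \<tau>)" .
  moreover have "(real j + 4) * (11 / 10 * \<eta> * \<tau>)
      = real j * (11 / 10 * \<eta> * \<tau>) + 11 / 10 * \<eta> * (3 * \<tau>) + 11 / 10 * \<eta> * \<tau>"
    by (simp add: algebra_simps)
  \<comment> \<open>The increments of \<Phi> around the loop add up to 0, so the crossing is bounded
    by the errors of the other pieces.\<close>
  ultimately have "2 * \<sigma> * c \<le> (real j + 4) * (11 / 10 * \<eta> * \<tau>)"
    using cross close by linarith
  also have "\<dots> = \<eta> * (11 / 10 * \<tau> * (real j + 4))" by (simp only: mult_ac)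
  also have "\<dots> = \<sigma> * c"
  proof -
    have "11 / 10 * \<tau> * (real j + 4) \<noteq> 0" using \<tau>(1) by simp
    then show ?thesis unfolding \<eta>_def by (rule nonzero_eq_divide_eq[THEN iffD1, OF _ refl])
  qed
  finally show False using mult_pos_pos[OF \<sigma> c] by simp
qed

section \<open>Excluding limit points of the critical set\<close>

lemma no_limit_pgrad_zeros:
  fixes w :: "nat \<Rightarrow> real ^ 'n"
  assumes stc: "strictly_two_convex w r" and r: "r \<ge> 1"
  shows "\<not> x islimpt {x. pgrad w r x = 0}"
proof -
  define Z where "Z = {x. pgrad w r x = 0}"
  \<comment> \<open>Isolated zeros are discarded, since they have no arc chart. The limit points
    form a closed set and all have one.\<close>
  define S where "S = {x. x islimpt Z}"
  have SZ: "S \<subseteq> Z" using closed_pgrad_zeros[of w r] by (auto simp: S_def Z_def closed_limpt)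
  obtain R where R: "\<And>x. pgrad w r x = 0 \<Longrightarrow> norm x \<le> R"
    using descent_step_constants[OF stc r] by metis
  have "S \<subseteq> cball 0 R" using SZ R by (auto simp: Z_def)
  then have "compact S"
    unfolding S_def using closed_limpts compact_cball by (metis bounded_cball bounded_subset compact_eq_bounded_closed)
  moreover have "\<exists>\<delta>>0. \<exists>k \<alpha>. arc_chart S \<delta> p k \<alpha>" if p: "p \<in> S" for p
  proof -
    have "p islimpt {x. pgrad w r x = 0}" using p by (simp add: S_def Z_def)
    from critical_arc[OF stc this] obtain k \<alpha> \<delta> where *: "\<delta> > 0" "norm k = 1"
      "\<And>s. \<bar>s\<bar> < \<delta> \<Longrightarrow> \<alpha> s islimpt Z \<and> k \<bullet> (\<alpha> s - p) = s
        \<and> (\<exists>v. (\<alpha> has_vector_derivative v) (at s) \<and> norm v \<le> 11 / 10)"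
      "\<And>x. x \<in> Z \<Longrightarrow> norm (x - p) < \<delta> \<Longrightarrow> x = \<alpha> (k \<bullet> (x - p))"
      unfolding Z_def by metis
    have "arc_chart S \<delta> p k \<alpha>" unfolding arc_chart_def using * SZ by (auto simp: S_def)
    then show ?thesis using *(1) by blast
  qed
  moreover have "\<exists>\<Phi>. tangential_primitive S \<eta> (\<lambda>x. (max 0 (\<rho> - (x - q) \<bullet> (x - q)))\<^sup>2) k \<Phi>"
    if \<eta>: "\<eta> > 0" for \<rho> q k \<eta>
  proof -
    obtain \<Phi> where \<Phi>: "\<And>x. pgrad w r x = 0 \<Longrightarrow> \<exists>\<Phi>'. (\<Phi> has_derivative \<Phi>') (at x) \<and>
     (\<forall>h. phess w r x h = 0 \<longrightarrow>
       \<bar>\<Phi>' h - ((max 0 (\<rho> - (x - q) \<bullet> (x - q)))\<^sup>2 *\<^sub>R k) \<bullet> h\<bar> \<le> \<eta> * norm h)"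
      by (rule approximate_primitive[OF stc r curl_bounded_bump \<eta>]) blast
    have "tangential_primitive S \<eta> (\<lambda>x. (max 0 (\<rho> - (x - q) \<bullet> (x - q)))\<^sup>2) k \<Phi>"
      unfolding tangential_primitive_def
    proof (intro allI impI)
      fix \<delta> p k' \<alpha> s v
      assume ch: "arc_chart S \<delta> p k' \<alpha>" and s: "\<bar>s\<bar> < \<delta>" and v: "(\<alpha> has_vector_derivative v) (at s)"
      have crit: "pgrad w r (\<alpha> u) = 0" if "\<bar>u\<bar> < \<delta>" for u
        using ch SZ that by (auto simp: arc_chart_def Z_def)
      have va: "(\<alpha> has_derivative (\<lambda>t. t *\<^sub>R v)) (at s)" using v by (simp add: has_vector_derivative_def)
      \<comment> \<open>Differentiating the vanishing gradient along the arc puts its velocity in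
        the kernel of the Hessian, where the approximate primitive is controlled.\<close>
      have "((\<lambda>u. pgrad w r (\<alpha> u)) has_derivative (\<lambda>t. phess w r (\<alpha> s) (t *\<^sub>R v))) (at s)"
        by (rule has_derivative_compose[OF va pgrad_has_derivative])
      moreover have "((\<lambda>u. pgrad w r (\<alpha> u)) has_derivative (\<lambda>t. 0)) (at s)"
        by (rule has_derivative_transform_within_open[OF has_derivative_const[of 0] open_ball[of 0 \<delta>]])
          (use crit s in auto)
      ultimately have "(\<lambda>t. phess w r (\<alpha> s) (t *\<^sub>R v)) = (\<lambda>t. 0)" by (rule has_derivative_unique)
      from fun_cong[OF this, of 1] have Hv: "phess w r (\<alpha> s) v = 0" by simp
      obtain \<Phi>' where \<Phi>': "(\<Phi> has_derivative \<Phi>') (at (\<alpha> s))"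
        "\<bar>\<Phi>' v - ((max 0 (\<rho> - (\<alpha> s - q) \<bullet> (\<alpha> s - q)))\<^sup>2 *\<^sub>R k) \<bullet> v\<bar> \<le> \<eta> * norm v"
        using \<Phi>[OF crit[OF s]] Hv by blast
      have "((\<lambda>u. \<Phi> (\<alpha> u)) has_derivative (\<lambda>t. \<Phi>' (t *\<^sub>R v))) (at s)"
        by (rule has_derivative_compose[OF va \<Phi>'(1)])
      moreover have "(\<lambda>t. \<Phi>' (t *\<^sub>R v)) = (*) (\<Phi>' v)"
        using linear_scale[OF has_derivative_linear[OF \<Phi>'(1)]] by (simp add: fun_eq_iff mult.commute)
      ultimately have "((\<lambda>u. \<Phi> (\<alpha> u)) has_real_derivative \<Phi>' v) (at s)"
        by (simp add: has_field_derivative_def)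
      then show "\<exists>d. ((\<lambda>s. \<Phi> (\<alpha> s)) has_real_derivative d) (at s) \<and>
          \<bar>d - (max 0 (\<rho> - (\<alpha> s - q) \<bullet> (\<alpha> s - q)))\<^sup>2 * (k \<bullet> v)\<bar> \<le> \<eta> * norm v"
        using \<Phi>'(2) by auto
    qed
    then show ?thesis by blast
  qed
  ultimately have "S = {}" by (rule no_compact_curve)
  then show ?thesis by (simp add: S_def Z_def)
qed

theorem theorem9p1:
  fixes w :: "nat \<Rightarrow> real ^ 'n" and r :: nat
  assumes "CARD('n) \<ge> 2"
    and "r \<ge> 1"
    and "inj_on w {..<r}"
  shows "(\<forall>x\<in>crit_points w r. \<exists>e>0. \<forall>y\<in>crit_points w r. dist y x < e \<longrightarrow> y = x)
         \<and> \<not> (\<exists>g. arc g \<and> path_image g \<subseteq> crit_points w r)"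
proof -
  have nolim: "\<not> x islimpt crit_points w r" for x
  proof (cases "strictly_two_convex w r")
    case True
    have "crit_points w r \<subseteq> {x. pgrad w r x = 0}" using crit_points_pgrad by blast
    then show ?thesis using no_limit_pgrad_zeros[OF True assms(2)] islimpt_subset by blast
  next
    case False
    from strictly_two_convex_or_planar[OF assms(3) False]
    have "finite (crit_points w r)"
      using finite_crit_points_planar[OF assms(2,3)] by metis
    then show ?thesis by (rule islimpt_finite)
  qed
  have "\<exists>e>0. \<forall>y\<in>crit_points w r. dist y x < e \<longrightarrow> y = x" for x
    using nolim[of x] by (auto simp: islimpt_approachable)
  moreover have "\<not> path_image g \<subseteq> crit_points w r" if "arc g" for g
  proof
    assume sub: "path_image g \<subseteq> crit_points w r"
    \<comment> \<open>An arc is an injective image of [0,1], so it is infinite, and compactness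
      gives it a limit point.\<close>
    have "infinite (path_image g)"
      using that by (simp add: arc_def path_image_def finite_image_iff)
    moreover have "compact (path_image g)" using that by (simp add: arc_imp_path compact_path_image)
    ultimately obtain x where "x islimpt path_image g"
      unfolding compact_eq_Bolzano_Weierstrass by blast
    then show False using nolim islimpt_subset[OF _ sub] by blast
  qed
  ultimately show ?thesis by blast
qed

end
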